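(* Let $X$ be a real Banach space, $Z$ a discrete subgroup of $X$, and let $n$ be the dimension of the vector space spanned by $Z$. Let $f:X\to\mathbb R$ be a locally Lipschitz functional which is $Z$-periodic, bounded from below, and satisfies the condition $(\mathrm{PS})_Z$. Then $f$ has at least $n+1$ distinct critical orbits.
   Context: $Z$ discrete means $\inf_{z\in Z\setminus\{0\}}\|z\|>0$. $f$ is $Z$-periodic if $f(x+z)=f(x)$ for all $x\in X$, $z\in Z$. The generalized directional derivative is $f^0(x,v)=\limsup_{y\to x,\ \mu\searrow0}\frac{f(y+\mu v)-f(y)}{\mu}$; the Clarke generalized gradient is $\partial f(x)=\{x^*\in X^*:\ f^0(x,v)\ge\langle x^*,v\rangle\ \text{for all }v\in X\}$; and $\lambda(x)=\min_{x^*\in\partial f(x)}\|x^*\|$. A point $x$ is critical if $0\in\partial f(x)$. Let $\pi:X\to X/Z$ be the canonical surjection, with $X/Z$ metrized by $d(\pi(x),\pi(y))=\inf_{z\in Z}\|x-y-z\|$. If $x$ is a critical point of $f$, the set $\pi^{-1}(\pi(x))$ (which consists of critical points) is called a critical orbit. $f$ satisfies $(\mathrm{PS})_Z$ if for every sequence $(x_n)$ in $X$ with $(f(x_n))$ bounded and $\lambda(x_n)\to0$, the sequence $(\pi(x_n))$ has a convergent subsequence (equivalently, up to a subsequence, there are $z_n\in Z$ with $(x_n-z_n)$ convergent). *)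

theory Defs
  imports "HOL-Analysis.Analysis" "HOL-Library.Extended_Nat"
begin

definition additive_subgroup :: "'a::ab_group_add set \<Rightarrow> bool" where
  "additive_subgroup Z \<longleftrightarrow>
     0 \<in> Z \<and> (\<forall>x\<in>Z. \<forall>y\<in>Z. x + y \<in> Z) \<and> (\<forall>x\<in>Z. - x \<in> Z)"

text \<open>The infimum is taken in the extended reals, so that the trivial group is discrete
  (the infimum of the empty set being infinite).\<close>

definition discrete_subgroup :: "'a::real_normed_vector set \<Rightarrow> bool" where
  "discrete_subgroup Z \<longleftrightarrow>
     additive_subgroup Z \<and> (INF z\<in>Z - {0}. ereal (norm z)) > 0"

definition periodic_wrt :: "'a::ab_group_add set \<Rightarrow> ('a \<Rightarrow> 'b) \<Rightarrow> bool" where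
  "periodic_wrt Z f \<longleftrightarrow> (\<forall>x. \<forall>z\<in>Z. f (x + z) = f x)"

definition locally_lipschitz :: "('a::metric_space \<Rightarrow> 'b::metric_space) \<Rightarrow> bool" where
  "locally_lipschitz f \<longleftrightarrow> (\<forall>x. \<exists>r>0. \<exists>L. L-lipschitz_on (ball x r) f)"

text \<open>The base point \<open>y\<close> tends to \<open>x\<close> along \<open>nhds x\<close>: the value \<open>y = x\<close> is allowed.
  The upper limit is taken in the extended reals; it is finite for locally Lipschitz \<open>f\<close>.\<close>

definition clarke_dderiv :: "('a::real_normed_vector \<Rightarrow> real) \<Rightarrow> 'a \<Rightarrow> 'a \<Rightarrow> ereal" where
  "clarke_dderiv f x v =
     Limsup (nhds x \<times>\<^sub>F at_right (0::real)) (\<lambda>(y, \<mu>). ereal ((f (y + \<mu> *\<^sub>R v) - f y) / \<mu>))"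

definition clarke_gradient ::
    "('a::real_normed_vector \<Rightarrow> real) \<Rightarrow> 'a \<Rightarrow> ('a \<Rightarrow>\<^sub>L real) set" where
  "clarke_gradient f x =
     {p. \<forall>v. clarke_dderiv f x v \<ge> ereal (blinfun_apply p v)}"

text \<open>For locally Lipschitz \<open>f\<close> the gradient is nonempty and weak-* compact, so the infimum
  below is a minimum.\<close>

definition min_gradient_norm :: "('a::real_normed_vector \<Rightarrow> real) \<Rightarrow> 'a \<Rightarrow> real" where
  "min_gradient_norm f x = (INF p\<in>clarke_gradient f x. norm p)"

definition critical_point :: "('a::real_normed_vector \<Rightarrow> real) \<Rightarrow> 'a \<Rightarrow> bool" where
  "critical_point f x \<longleftrightarrow> 0 \<in> clarke_gradient f x"

text \<open>The points of the quotient \<open>X/Z\<close> are the cosets of \<open>Z\<close>, i.e. the elements of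
  \<open>range (coset_map Z)\<close>.\<close>

definition coset_map :: "'a::ab_group_add set \<Rightarrow> 'a \<Rightarrow> 'a set" where
  "coset_map Z x = (\<lambda>z. x + z) ` Z"

text \<open>The infimum also runs over the representatives \<open>x\<close>, \<open>y\<close> of the two cosets; by
  \<open>quotient_dist_coset_map\<close> below it does not depend on them.\<close>

definition quotient_dist ::
    "'a::real_normed_vector set \<Rightarrow> 'a set \<Rightarrow> 'a set \<Rightarrow> real" where
  "quotient_dist Z A B = Inf {norm (x - y - z) | x y z. x \<in> A \<and> y \<in> B \<and> z \<in> Z}"

lemma quotient_dist_coset_map:
  assumes "additive_subgroup Z"
  shows "quotient_dist Z (coset_map Z x) (coset_map Z y) = (INF z\<in>Z. norm (x - y - z))"
proof -
  have "{norm (a - b - z) | a b z. a \<in> coset_map Z x \<and> b \<in> coset_map Z y \<and> z \<in> Z}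
        = (\<lambda>z. norm (x - y - z)) ` Z" (is "?L = ?R")
  proof
    show "?L \<subseteq> ?R"
    proof
      fix t assume "t \<in> ?L"
      then obtain u v z where h: "u \<in> Z" "v \<in> Z" "z \<in> Z" "t = norm ((x + u) - (y + v) - z)"
        by (auto simp: coset_map_def)
      have "- u + v + z \<in> Z"
        using assms h unfolding additive_subgroup_def by blast
      moreover have "t = norm (x - y - (- u + v + z))"
        using h(4) by (simp add: algebra_simps)
      ultimately show "t \<in> ?R" by blast
    qed
    have z: "0 \<in> Z" using assms by (simp add: additive_subgroup_def)
    have "x \<in> coset_map Z x" "y \<in> coset_map Z y"
      using z by (auto simp: coset_map_def intro: image_eqI[where x = 0])
    then show "?R \<subseteq> ?L" by blast
  qed
  then show ?thesis by (simp add: quotient_dist_def)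
qed

definition PS_condition :: "'a::real_normed_vector set \<Rightarrow> ('a \<Rightarrow> real) \<Rightarrow> bool" where
  "PS_condition Z f \<longleftrightarrow>
     (\<forall>x :: nat \<Rightarrow> 'a.
        bounded (range (\<lambda>n. f (x n))) \<and> (\<lambda>n. min_gradient_norm f (x n)) \<longlonglongrightarrow> 0 \<longrightarrow>
        (\<exists>r. strict_mono r \<and>
           (\<exists>A\<in>range (coset_map Z).
              (\<lambda>k. quotient_dist Z (coset_map Z (x (r k))) A) \<longlonglongrightarrow> 0)))"

definition critical_orbits :: "'a::real_normed_vector set \<Rightarrow> ('a \<Rightarrow> real) \<Rightarrow> 'a set set" where
  "critical_orbits Z f =
     {coset_map Z -` {coset_map Z x} | x. critical_point f x}"

text \<open>The library functions \<open>dim\<close> and \<open>card\<close> return \<open>0\<close> on infinite-dimensional,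
  respectively infinite, arguments; here the value is \<open>\<infinity>\<close> in these cases.\<close>

definition edim :: "'a::real_vector set \<Rightarrow> enat" where
  "edim V = (if \<exists>B. finite B \<and> V \<subseteq> span B then enat (dim V) else \<infinity>)"

definition ecard :: "'b set \<Rightarrow> enat" where
  "ecard A = (if finite A then enat (card A) else \<infinity>)"

end

theory Submission
  imports Defs
begin

text \<open>Suppose that there are at most \<open>n\<close> critical orbits, pick as many linearly independent elements
  \<open>B\<close> of \<open>Z\<close> as there are critical orbits, and let \<open>V = span B + Z\<close>. Consider closed \<open>Z\<close>-invariant sets
  \<open>A \<subseteq> V\<close> together with \<open>Z\<close>-equivariant continuous maps \<open>u \<mapsto> u + h u\<close>, where \<open>h\<close> is bounded and
  \<open>Z\<close>-periodic. If such a map sends \<open>A\<close> below the level \<open>a\<close>, then \<open>A\<close> can be coloured by the critical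
  orbits of level at most \<open>a\<close> in such a way that each colour class splits into uniformly separated
  pieces of uniformly bounded size. To pass a level \<open>c\<close>, the points of \<open>A\<close> sent close to a critical
  orbit of level \<open>c\<close> receive this orbit as colour, with one piece for each point of the orbit. If the
  remaining part of \<open>A\<close> could not be coloured by the lower orbits, then no equivariant perturbation
  could push it below \<open>c\<close>, and Ekeland's principle on the complete space of periodic maps \<open>h\<close>, combined
  with the Palais-Smale condition, would produce a further critical point of level \<open>c\<close>.

  Hence \<open>V\<close>, and so \<open>span B\<close>, can be coloured with only \<open>dim (span B)\<close> colours. This contradicts
  Lebesgue's covering theorem, which follows from Kuhn's combinatorial lemma. The pieces have bounded
  size because \<open>h\<close> is bounded: a piece is mapped close to a single point by \<open>u \<mapsto> u + h u\<close>.\<close>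

section \<open>Dominated linear functionals\<close>

definition sublinear :: "('a::real_vector \<Rightarrow> real) \<Rightarrow> bool" where
  "sublinear q \<longleftrightarrow> (\<forall>x y. q (x + y) \<le> q x + q y) \<and> (\<forall>t>0. \<forall>x. q (t *\<^sub>R x) = t * q x)"

text \<open>The inequality for \<open>inverse t\<close> at the point \<open>t *\<^sub>R x\<close> is
  the reverse inequality for \<open>t\<close>.\<close>

lemma sublinearI:
  assumes "\<And>x y. q (x + y) \<le> q x + q y" "\<And>t x. t > 0 \<Longrightarrow> q (t *\<^sub>R x) \<le> t * q x"
  shows "sublinear q"
proof -
  have "q (t *\<^sub>R x) = t * q x" if "t > 0" for t x
  proof (rule antisym)
    have "q x \<le> inverse t * q (t *\<^sub>R x)"
      using assms(2)[of "inverse t" "t *\<^sub>R x"] that by simp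
    then show "t * q x \<le> q (t *\<^sub>R x)"
      using that by (simp add: field_simps)
  qed (use assms(2) that in auto)
  then show ?thesis
    using assms(1) by (simp add: sublinear_def)
qed

lemma
  assumes "sublinear q"
  shows sublinear_add: "q (x + y) \<le> q x + q y"
    and sublinear_zero: "q 0 = 0"
    and sublinear_scaleR: "t \<ge> 0 \<Longrightarrow> q (t *\<^sub>R x) = t * q x"
    and sublinear_lower: "- q (- x) \<le> q x"
proof -
  show add: "q (x + y) \<le> q x + q y" for x y
    using assms by (auto simp: sublinear_def)
  have s: "q (t *\<^sub>R x) = t * q x" if "t > 0" for t x
    using assms that by (auto simp: sublinear_def)
  show z: "q 0 = 0"
    using s[of 2 0] by simp
  show "q (t *\<^sub>R x) = t * q x" if "t \<ge> 0"
    using s[of t x] that z by (cases "t = 0") auto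
  show "- q (- x) \<le> q x"
    using add[of x "- x"] z by simp
qed

text \<open>Provides the bounds of chains for Zorn's lemma. Two members of the chain can be replaced
  by the smaller one, which makes the infimum subadditive; it is finite because \<open>q x\<close>
  is at least \<open>- q (- x)\<close>, hence at least \<open>- q0 (- x)\<close>.\<close>

lemma sublinear_Inf_chain:
  assumes C: "C \<noteq> {}" "\<And>q. q \<in> C \<Longrightarrow> sublinear q \<and> q \<le> q0"
    and chain: "\<And>q r. q \<in> C \<Longrightarrow> r \<in> C \<Longrightarrow> q \<le> r \<or> r \<le> q"
  shows "sublinear (\<lambda>x. INF q\<in>C. q x)" "\<And>q. q \<in> C \<Longrightarrow> (\<lambda>x. INF q\<in>C. q x) \<le> q"
proof -
  have bdd: "bdd_below ((\<lambda>q. q x) ` C)" for x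
  proof (rule bdd_belowI2)
    fix q assume q: "q \<in> C"
    then show "- q0 (- x) \<le> q x"
      using sublinear_lower[of q x] C(2)[OF q] by (auto simp: le_fun_def) (meson le_minus_iff minus_le_iff order_trans)
  qed
  then show lower: "(\<lambda>x. INF q\<in>C. q x) \<le> q" if "q \<in> C" for q
    using that by (auto simp: le_fun_def intro: cINF_lower)
  show "sublinear (\<lambda>x. INF q\<in>C. q x)"
  proof (rule sublinearI)
    fix x y
    have *: "(INF q\<in>C. q (x + y)) \<le> q x + r y" if qr: "q \<in> C" "r \<in> C" for q r
    proof -
      obtain p where p: "p \<in> C" "p \<le> q" "p \<le> r"
        using chain[OF qr] qr by blast
      have "(INF q\<in>C. q (x + y)) \<le> p (x + y)"
        using lower[OF p(1)] by (auto simp: le_fun_def)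
      also have "\<dots> \<le> p x + p y"
        using C(2)[OF p(1)] sublinear_add by blast
      also have "\<dots> \<le> q x + r y"
        using p by (auto simp: le_fun_def intro: add_mono)
      finally show ?thesis .
    qed
    have "(INF q\<in>C. q (x + y)) - r y \<le> (INF q\<in>C. q x)" if "r \<in> C" for r
      using *[OF _ that] by (intro cINF_greatest C) (simp add: algebra_simps)
    then have "(INF q\<in>C. q (x + y)) - (INF q\<in>C. q x) \<le> (INF q\<in>C. q y)"
      by (intro cINF_greatest C) (simp add: algebra_simps)
    then show "(INF q\<in>C. q (x + y)) \<le> (INF q\<in>C. q x) + (INF q\<in>C. q y)"
      by simp
  next
    fix t :: real and x assume t: "t > 0"
    have "(INF q\<in>C. q (t *\<^sub>R x)) / t \<le> q x" if "q \<in> C" for q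
      using lower[OF that] sublinear_scaleR[of q t x] C(2)[OF that] t
      by (auto simp: le_fun_def field_simps) metis
    then have "(INF q\<in>C. q (t *\<^sub>R x)) / t \<le> (INF q\<in>C. q x)"
      by (intro cINF_greatest C)
    then show "(INF q\<in>C. q (t *\<^sub>R x)) \<le> t * (INF q\<in>C. q x)"
      using t by (simp add: field_simps)
  qed
qed

text \<open>For fixed \<open>y\<close> the functional \<open>r\<close> below is sublinear and at
  most \<open>m\<close>, hence equal to \<open>m\<close> by minimality. Its term
  \<open>t = 1\<close> gives superadditivity.\<close>

lemma minimal_sublinear_linear:
  assumes m: "sublinear m" and min: "\<And>r. sublinear r \<Longrightarrow> r \<le> m \<Longrightarrow> r = m"
  shows "linear m"
proof -
  have super: "m x + m y \<le> m (x + y)" for x y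
  proof -
    define r where "r x = (INF t\<in>{0..}. m (x + t *\<^sub>R y) - t * m y)" for x
    have lb: "- m (- x) \<le> m (x + t *\<^sub>R y) - t * m y" if "t \<ge> 0" for x t
      using sublinear_add[OF m, of "x + t *\<^sub>R y" "- x"] sublinear_scaleR[OF m that, of y] by simp
    have low: "r x \<le> m (x + t *\<^sub>R y) - t * m y" if "t \<ge> 0" for x t
      unfolding r_def using that lb by (intro cINF_lower bdd_belowI2[of _ "- m (- x)"]) auto
    have "sublinear r"
    proof (rule sublinearI)
      fix x x'
      have *: "r (x + x') \<le> (m (x + s *\<^sub>R y) - s * m y) + (m (x' + t *\<^sub>R y) - t * m y)"
        if "s \<ge> 0" "t \<ge> 0" for s t
        using low[of "s + t" "x + x'"] sublinear_add[OF m, of "x + s *\<^sub>R y" "x' + t *\<^sub>R y"] that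
        by (simp add: algebra_simps)
      have "r (x + x') - (m (x' + t *\<^sub>R y) - t * m y) \<le> r x" if "t \<ge> 0" for t
        unfolding r_def[of x] using *[OF _ that] by (intro cINF_greatest) (auto simp: algebra_simps)
      then have "r (x + x') - r x \<le> r x'"
        unfolding r_def[of x'] by (intro cINF_greatest) (auto simp: algebra_simps)
      then show "r (x + x') \<le> r x + r x'"
        by simp
    next
      fix t :: real and x assume t: "t > 0"
      have "r (t *\<^sub>R x) / t \<le> m (x + s *\<^sub>R y) - s * m y" if "s \<ge> 0" for s
        using low[of "t * s" "t *\<^sub>R x"] sublinear_scaleR[OF m, of t "x + s *\<^sub>R y"] t that
        by (simp add: field_simps scaleR_add_right)
      then have "r (t *\<^sub>R x) / t \<le> r x"
        unfolding r_def[of x] by (intro cINF_greatest) auto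
      then show "r (t *\<^sub>R x) \<le> t * r x"
        using t by (simp add: field_simps)
    qed
    moreover have "r \<le> m"
      using low[of 0] by (auto simp: le_fun_def)
    ultimately have "r = m" by (rule min)
    with low[of 1 x] show ?thesis by simp
  qed
  have add: "m (x + y) = m x + m y" for x y
    using super[of x y] sublinear_add[OF m, of x y] by simp
  have neg: "m (- x) = - m x" for x
    using add[of x "- x"] sublinear_zero[OF m] by simp
  show ?thesis
  proof (rule linearI)
    show "m (t *\<^sub>R x) = t *\<^sub>R m x" for t x
    proof (cases "t \<ge> 0")
      case False
      then show ?thesis
        using sublinear_scaleR[OF m, of "- t" x] neg[of "t *\<^sub>R x"] by simp
    qed (simp add: sublinear_scaleR[OF m])
  qed (rule add)
qed

text \<open>Zorn's lemma for the reversed order yields a minimal sublinear functional below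
  \<open>q\<close>, and minimality forces linearity.\<close>

lemma Hahn_Banach_sublinear:
  assumes q: "sublinear q"
  obtains p where "linear p" "\<And>x. p x \<le> q x"
proof -
  let ?A = "{r. sublinear r \<and> r \<le> q}"
  have "\<exists>m\<in>?A. \<forall>r\<in>?A. m \<ge> r \<longrightarrow> r = m"
  proof (rule predicate_Zorn)
    show "partial_order_on ?A (relation_of (\<ge>) ?A)"
      by (auto simp: partial_order_on_def preorder_on_def refl_on_def trans_def antisym_def relation_of_def)
  next
    fix C assume "C \<in> Chains (relation_of (\<ge>) ?A)"
    then have C: "\<And>r. r \<in> C \<Longrightarrow> sublinear r \<and> r \<le> q" "\<And>r s. r \<in> C \<Longrightarrow> s \<in> C \<Longrightarrow> r \<le> s \<or> s \<le> r"
      by (auto simp: Chains_def relation_of_def)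
    show "\<exists>u\<in>?A. \<forall>a\<in>C. a \<ge> u"
    proof (cases "C = {}")
      case False
      then obtain c where "c \<in> C" by blast
      with sublinear_Inf_chain[OF False C] C(1) show ?thesis
        by (intro bexI[of _ "\<lambda>x. INF r\<in>C. r x"]) (auto intro: order_trans)
    qed (use q in auto)
  qed
  then obtain m where "sublinear m" "m \<le> q" "\<And>r. sublinear r \<Longrightarrow> r \<le> m \<Longrightarrow> r = m"
    by (auto intro: order_trans)
  then show ?thesis
    using minimal_sublinear_linear[of m] that by (auto simp: le_fun_def)
qed

section \<open>Ekeland's variational principle\<close>

text \<open>The assumption \<open>lsc\<close> is lower semicontinuity, phrased through sublevel
  sets. The point is the limit of a sequence in which each term almost minimizes
  \<open>\<Psi>\<close> among the points that improve the preceding term at rate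
  \<open>\<kappa>\<close>.\<close>

lemma Ekeland_variational_principle:
  fixes \<Psi> :: "'a::metric_space \<Rightarrow> real"
  assumes S: "complete S" "h0 \<in> S" and \<kappa>: "\<kappa> > 0"
    and bound: "\<And>h. h \<in> S \<Longrightarrow> m \<le> \<Psi> h"
    and lsc: "\<And>s l a. \<lbrakk>\<And>k. s k \<in> S; \<And>k. \<Psi> (s k) \<le> a; s \<longlonglongrightarrow> l\<rbrakk> \<Longrightarrow> \<Psi> l \<le> a"
  obtains h where "h \<in> S" "\<Psi> h + \<kappa> * dist h0 h \<le> \<Psi> h0"
    "\<And>h'. \<lbrakk>h' \<in> S; \<Psi> h' + \<kappa> * dist h h' \<le> \<Psi> h\<rbrakk> \<Longrightarrow> h' = h"
proof -
  \<comment> \<open>The relation \<open>h' \<in> T h\<close> is transitive by the triangle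
    inequality, so these sets shrink along the sequence \<open>s\<close>.\<close>
  define T where "T h = {h'\<in>S. \<Psi> h' + \<kappa> * dist h h' \<le> \<Psi> h}" for h
  have self: "h \<in> T h" if "h \<in> S" for h
    using that by (simp add: T_def)
  have trans: "h'' \<in> T h" if "h' \<in> T h" "h'' \<in> T h'" for h h' h''
  proof -
    have "\<kappa> * dist h h'' \<le> \<kappa> * dist h h' + \<kappa> * dist h' h''"
      using \<kappa> dist_triangle[of h h'' h'] by (simp flip: distrib_left)
    then show ?thesis using that by (auto simp: T_def)
  qed
  have bdd: "bdd_below (\<Psi> ` T h)" for h
    using bound by (intro bdd_belowI2[of _ m]) (auto simp: T_def)
  have "\<exists>h'\<in>T h. \<Psi> h' < (INF g\<in>T h. \<Psi> g) + inverse (real (Suc k))" if "h \<in> S" for h k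
    using cInf_lessD[of "\<Psi> ` T h" "(INF g\<in>T h. \<Psi> g) + inverse (real (Suc k))"] self[OF that] by auto
  then obtain nxt where nxt: "\<And>h k. h \<in> S \<Longrightarrow>
      nxt h k \<in> T h \<and> \<Psi> (nxt h k) < (INF g\<in>T h. \<Psi> g) + inverse (real (Suc k))"
    by metis
  define s where "s = rec_nat h0 (\<lambda>k h. nxt h k)"
  have s0: "s 0 = h0" and sS: "s (Suc k) = nxt (s k) k" for k
    by (simp_all add: s_def)
  have inS: "s k \<in> S" for k
    by (induction k) (use S nxt sS s0 in \<open>auto simp: T_def\<close>)
  have chain: "s j \<in> T (s i)" if "i \<le> j" for i j
    using that
  proof (induction j rule: dec_induct)
    case (step j)
    then show ?case using trans nxt[OF inS[of j]] by (simp add: sS)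
  qed (simp add: self inS)
  have dec: "\<Psi> (s j) + \<kappa> * dist (s i) (s j) \<le> \<Psi> (s i)" if "i \<le> j" for i j
    using chain[OF that] by (simp add: T_def)
  have "decseq (\<lambda>k. \<Psi> (s k))"
    using dec \<kappa> by (intro decseq_SucI) (smt (verit) zero_le_dist mult_nonneg_nonneg le_SucI order_refl)
  then obtain L where L: "(\<lambda>k. \<Psi> (s k)) \<longlonglongrightarrow> L" "\<And>k. L \<le> \<Psi> (s k)"
    using decseq_convergent[of "\<lambda>k. \<Psi> (s k)" m] bound inS by metis
  \<comment> \<open>The values \<open>\<Psi> (s k)\<close> converge, and their differences bound
    \<open>\<kappa>\<close> times the distances.\<close>
  have "Cauchy s"
  proof (rule metric_CauchyI)
    fix e :: real assume "e > 0"
    then have "eventually (\<lambda>k. \<Psi> (s k) < L + \<kappa> * e / 2) sequentially"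
      using L(1) \<kappa> by (intro order_tendstoD(2)[OF L(1)]) auto
    then obtain N where N: "\<Psi> (s k) < L + \<kappa> * e / 2" if "k \<ge> N" for k
      by (auto simp: eventually_sequentially)
    have *: "dist (s N) (s k) < e / 2" if "k \<ge> N" for k
    proof -
      have "\<kappa> * dist (s N) (s k) < \<kappa> * (e / 2)"
        using dec[OF that] N[of N] L(2)[of k] by simp
      then show ?thesis using \<kappa> by simp
    qed
    have "dist (s i) (s j) < e" if "i \<ge> N" "j \<ge> N" for i j
      using dist_triangle3[of "s i" "s j" "s N"] *[OF that(1)] *[OF that(2)] by simp
    then show "\<exists>M. \<forall>i\<ge>M. \<forall>j\<ge>M. dist (s i) (s j) < e" by blast
  qed
  then obtain l where l: "l \<in> S" "s \<longlonglongrightarrow> l"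
    using S(1) inS unfolding complete_def by blast
  have "\<Psi> l \<le> \<Psi> (s k)" for k
  proof (rule lsc)
    show "(\<lambda>j. s (j + k)) \<longlonglongrightarrow> l" using l(2) by (rule LIMSEQ_ignore_initial_segment)
    show "\<Psi> (s (j + k)) \<le> \<Psi> (s k)" for j
      using dec[of k "j + k"] \<kappa> by (smt (verit) le_add2 mult_nonneg_nonneg zero_le_dist)
  qed (rule inS)
  then have lL: "\<Psi> l \<le> L"
    using L(1) by (intro LIMSEQ_le_const[of "\<lambda>k. \<Psi> (s k)"]) auto
  have lT: "l \<in> T (s k)" for k
  proof -
    have "L + \<kappa> * dist (s k) l \<le> \<Psi> (s k)"
    proof (rule LIMSEQ_le_const2)
      show "(\<lambda>j. \<Psi> (s j) + \<kappa> * dist (s k) (s j)) \<longlonglongrightarrow> L + \<kappa> * dist (s k) l"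
        by (intro tendsto_intros L(1) l(2))
      show "\<exists>N. \<forall>j\<ge>N. \<Psi> (s j) + \<kappa> * dist (s k) (s j) \<le> \<Psi> (s k)"
        using dec by blast
    qed
    then show ?thesis using lL l(1) by (simp add: T_def)
  qed
  show ?thesis
  proof
    show "l \<in> S" by (rule l)
    show "\<Psi> l + \<kappa> * dist h0 l \<le> \<Psi> h0"
      using lT[of 0] by (simp add: T_def s0)
  next
    \<comment> \<open>Such an \<open>h'\<close> lies in every \<open>T (s k)\<close>, on which the
      infimum of \<open>\<Psi>\<close> is within \<open>inverse (real (Suc k))\<close> of
      \<open>\<Psi> (s (Suc k))\<close>. Hence \<open>\<Psi> h'\<close> is not below
      \<open>\<Psi> l\<close>, and the distance must vanish.\<close>
    fix h' assume h': "h' \<in> S" "\<Psi> h' + \<kappa> * dist l h' \<le> \<Psi> l"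
    then have "h' \<in> T l" by (simp add: T_def)
    have "\<Psi> l - inverse (real (Suc k)) \<le> \<Psi> h'" for k
    proof -
      have "(INF g\<in>T (s k). \<Psi> g) \<le> \<Psi> h'"
        using trans[OF lT \<open>h' \<in> T l\<close>] bdd by (intro cINF_lower)
      moreover have "\<Psi> (s (Suc k)) < (INF g\<in>T (s k). \<Psi> g) + inverse (real (Suc k))"
        using nxt[OF inS[of k]] by (simp add: sS)
      moreover have "\<Psi> l \<le> \<Psi> (s (Suc k))"
        using lL L(2) order_trans by blast
      ultimately show ?thesis by linarith
    qed
    moreover have "(\<lambda>k. \<Psi> l - inverse (real (Suc k))) \<longlonglongrightarrow> \<Psi> l - 0"
      by (intro tendsto_intros LIMSEQ_inverse_real_of_nat)
    ultimately have "\<Psi> l - 0 \<le> \<Psi> h'"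
      by (intro LIMSEQ_le_const2) auto
    then have "\<kappa> * dist l h' \<le> 0" using h'(2) by linarith
    then show "h' = l" using \<kappa> by (simp add: mult_le_0_iff)
  qed
qed

section \<open>Colourings with bounded pieces\<close>

text \<open>\<open>c\<close> is the colour and \<open>p\<close> a label of the piece; labels are
  compared only within one colour. They are points of the space because critical points serve as
  labels later.\<close>

definition colouring ::
    "'c set \<Rightarrow> 'a::metric_space set \<Rightarrow> ('a \<Rightarrow> 'c) \<Rightarrow> ('a \<Rightarrow> 'a) \<Rightarrow> real \<Rightarrow> real \<Rightarrow> bool" where
  "colouring C A c p \<epsilon> K \<longleftrightarrow> \<epsilon> > 0 \<and> c ` A \<subseteq> C \<and>
     (\<forall>u\<in>A. \<forall>v\<in>A. c u = c v \<and> dist u v \<le> \<epsilon> \<longrightarrow> p u = p v) \<and>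
     (\<forall>u\<in>A. \<forall>v\<in>A. c u = c v \<and> p u = p v \<longrightarrow> dist u v \<le> K)"

definition colourable :: "'c set \<Rightarrow> 'a::metric_space set \<Rightarrow> bool" where
  "colourable C A \<longleftrightarrow> (\<exists>c p \<epsilon> K. colouring C A c p \<epsilon> K)"

lemma colouringD:
  assumes "colouring C A c p \<epsilon> K"
  shows "\<epsilon> > 0" "c ` A \<subseteq> C"
    "\<And>u v. \<lbrakk>u \<in> A; v \<in> A; c u = c v; dist u v \<le> \<epsilon>\<rbrakk> \<Longrightarrow> p u = p v"
    "\<And>u v. \<lbrakk>u \<in> A; v \<in> A; c u = c v; p u = p v\<rbrakk> \<Longrightarrow> dist u v \<le> K"
proof -
  show "\<epsilon> > 0"
    using assms unfolding colouring_def by (elim conjE)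
  show "c ` A \<subseteq> C"
    using assms unfolding colouring_def by (elim conjE)
  have 1: "\<forall>u\<in>A. \<forall>v\<in>A. c u = c v \<and> dist u v \<le> \<epsilon> \<longrightarrow> p u = p v"
    using assms unfolding colouring_def by (elim conjE)
  have 2: "\<forall>u\<in>A. \<forall>v\<in>A. c u = c v \<and> p u = p v \<longrightarrow> dist u v \<le> K"
    using assms unfolding colouring_def by (elim conjE)
  show "p u = p v" if "u \<in> A" "v \<in> A" "c u = c v" "dist u v \<le> \<epsilon>" for u v
    using that by (intro 1[rule_format] conjI)
  show "dist u v \<le> K" if "u \<in> A" "v \<in> A" "c u = c v" "p u = p v" for u v
    using that by (intro 2[rule_format] conjI)
qed

lemma colourable_mono:
  assumes "colourable C A" "C \<subseteq> D" "B \<subseteq> A"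
  shows "colourable D B"
proof -
  obtain c p \<epsilon> K where "colouring C A c p \<epsilon> K"
    using assms(1) by (auto simp: colourable_def)
  then have "colouring D B c p \<epsilon> K"
    using assms(2,3) unfolding colouring_def image_subset_iff by (simp add: subset_iff)
  then show ?thesis unfolding colourable_def by (intro exI)
qed

lemma colourable_empty: "colourable C {}"
proof -
  have "colouring C {} c p 1 0" for c p
    by (simp add: colouring_def)
  then show ?thesis unfolding colourable_def by (intro exI)
qed

text \<open>Points of \<open>A\<close> keep their old colour and piece. Since the colours are
  disjoint, a point of \<open>A\<close> and a point outside \<open>A\<close> never have to be
  compared.\<close>

lemma colourable_Un:
  assumes "colourable C A" "colourable D B" "C \<inter> D = {}"
  shows "colourable (C \<union> D) (A \<union> B)"
proof -
  obtain c p \<epsilon> K where "colouring C A c p \<epsilon> K"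
    using assms(1) by (auto simp: colourable_def)
  note cA = colouringD[OF this]
  obtain c' p' \<epsilon>' K' where "colouring D B c' p' \<epsilon>' K'"
    using assms(2) by (auto simp: colourable_def)
  note cB = colouringD[OF this]
  let ?c = "\<lambda>u. if u \<in> A then c u else c' u"
  let ?p = "\<lambda>u. if u \<in> A then p u else p' u"
  have ne: "c u \<noteq> c' v" if "u \<in> A" "v \<in> B" for u v
  proof -
    have "c u \<in> C" "c' v \<in> D"
      using cA(2) cB(2) that by (simp_all add: image_subset_iff)
    then show ?thesis using assms(3) by auto
  qed
  have "colouring (C \<union> D) (A \<union> B) ?c ?p (min \<epsilon> \<epsilon>') (max K K')"
    unfolding colouring_def
  proof (intro conjI ballI impI)
    fix u v assume uv: "u \<in> A \<union> B" "v \<in> A \<union> B"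
    consider "u \<in> A" "v \<in> A" | "u \<in> A" "v \<notin> A" "v \<in> B" | "u \<notin> A" "u \<in> B" "v \<in> A"
      | "u \<notin> A" "u \<in> B" "v \<notin> A" "v \<in> B"
      using uv by blast
    note cases = this
    show "?p u = ?p v" if *: "?c u = ?c v \<and> dist u v \<le> min \<epsilon> \<epsilon>'"
    proof (cases rule: cases)
      case 1 then show ?thesis using * cA(3)[of u v] by simp
    next
      case 2 then show ?thesis using * ne[of u v] by simp
    next
      case 3 then show ?thesis using * ne[of v u] by simp
    next
      case 4 then show ?thesis using * cB(3)[of u v] by simp
    qed
    show "dist u v \<le> max K K'" if *: "?c u = ?c v \<and> ?p u = ?p v"
    proof (cases rule: cases)
      case 1 then show ?thesis using * cA(4)[of u v] by simp
    next
      case 2 then show ?thesis using * ne[of u v] by simp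
    next
      case 3 then show ?thesis using * ne[of v u] by simp
    next
      case 4 then show ?thesis using * cB(4)[of u v] by simp
    qed
  qed (use cA(1,2) cB(1,2) in auto)
  then show ?thesis unfolding colourable_def by (intro exI)
qed

section \<open>Lebesgue's covering theorem for the span of a finite independent set\<close>

definition cube :: "'a::real_vector set \<Rightarrow> 'a set" where
  "cube B = {\<Sum>b\<in>B. t b *\<^sub>R b | t. \<forall>b\<in>B. \<bar>t b\<bar> \<le> 1}"

text \<open>Each new vector contributes a Minkowski sum with a compact segment.\<close>

lemma compact_cube:
  fixes B :: "'a::real_normed_vector set"
  assumes "finite B"
  shows "compact (cube B)"
  using assms
proof (induction B)
  case (insert b B)
  have "cube (insert b B) = {x + y | x y. x \<in> (\<lambda>t. t *\<^sub>R b) ` {-1..1} \<and> y \<in> cube B}" (is "_ = ?R")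
  proof
    show "cube (insert b B) \<subseteq> ?R"
    proof
      fix x assume "x \<in> cube (insert b B)"
      then obtain t where t: "x = (\<Sum>b\<in>insert b B. t b *\<^sub>R b)" "\<forall>b\<in>insert b B. \<bar>t b\<bar> \<le> 1"
        unfolding cube_def by blast
      have "x = t b *\<^sub>R b + (\<Sum>b\<in>B. t b *\<^sub>R b)"
        using insert.hyps t(1) by simp
      moreover have "\<bar>t b\<bar> \<le> 1"
        using t(2) by blast
      then have "t b *\<^sub>R b \<in> (\<lambda>t. t *\<^sub>R b) ` {-1..1}"
        by (intro imageI) (simp add: abs_le_iff)
      moreover have "(\<Sum>b\<in>B. t b *\<^sub>R b) \<in> cube B"
        using t(2) unfolding cube_def by blast
      ultimately show "x \<in> ?R"
        unfolding mem_Collect_eq by (intro exI conjI)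
    qed
    show "?R \<subseteq> cube (insert b B)"
    proof clarify
      fix t :: real and y assume t: "t \<in> {-1..1}" and "y \<in> cube B"
      then obtain s where s: "y = (\<Sum>b\<in>B. s b *\<^sub>R b)" "\<forall>b\<in>B. \<bar>s b\<bar> \<le> 1"
        by (auto simp: cube_def)
      let ?s = "s(b := t)"
      have "(\<Sum>b\<in>B. s b *\<^sub>R b) = (\<Sum>b\<in>B. ?s b *\<^sub>R b)"
        using insert.hyps by (intro sum.cong) auto
      then have "t *\<^sub>R b + y = (\<Sum>b\<in>insert b B. ?s b *\<^sub>R b)"
        using insert.hyps s(1) by simp
      moreover have "\<forall>b\<in>insert b B. \<bar>?s b\<bar> \<le> 1"
        using s t by auto
      ultimately show "t *\<^sub>R b + y \<in> cube (insert b B)"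
        unfolding cube_def by blast
    qed
  qed
  moreover have "compact ((\<lambda>t. t *\<^sub>R b) ` {-1..1::real})"
    by (intro compact_continuous_image continuous_intros compact_Icc)
  ultimately show ?case
    using insert.IH compact_sums by simp
qed (simp add: cube_def)

text \<open>\<open>D\<close> consists of the combinations with one coefficient 1 and the others of
  modulus at most 1. It is compact and avoids 0 by independence, so it has a distance
  \<open>m\<close> from 0; dividing by the largest coefficient moves any nonzero combination into
  \<open>D\<close>.\<close>

lemma independent_coordinate_bound:
  fixes B :: "'a::real_normed_vector set"
  assumes "independent B" "finite B"
  obtains m where "m > 0" "\<And>t b. b \<in> B \<Longrightarrow> m * \<bar>t b\<bar> \<le> norm (\<Sum>b\<in>B. t b *\<^sub>R b)"
proof -
  define D where "D = (\<Union>b\<in>B. (\<lambda>y. b + y) ` cube (B - {b}))"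
  have mem: "b + (\<Sum>a\<in>B - {b}. t a *\<^sub>R a) \<in> D" if "b \<in> B" "\<forall>a\<in>B - {b}. \<bar>t a\<bar> \<le> 1" for b t
    using that unfolding D_def cube_def by blast
  have "compact D"
    unfolding D_def using assms by (intro compact_UN compact_translation compact_cube) auto
  have "0 \<notin> D"
  proof
    assume "0 \<in> D"
    then obtain b t where b: "b \<in> B" "0 = b + (\<Sum>a\<in>B - {b}. t a *\<^sub>R a)"
      by (auto simp: D_def cube_def)
    then have "b = - (\<Sum>a\<in>B - {b}. t a *\<^sub>R a)"
      by (simp add: eq_neg_iff_add_eq_0)
    moreover have "- (\<Sum>a\<in>B - {b}. t a *\<^sub>R a) \<in> span (B - {b})"
      by (intro span_neg span_sum span_scale span_base)
    ultimately show False
      using assms(1) b(1) unfolding dependent_def by metis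
  qed
  have "open (- D)" "0 \<in> - D"
    using \<open>compact D\<close> \<open>0 \<notin> D\<close> by (auto intro: compact_imp_closed)
  then obtain m where "m > 0" "ball 0 m \<subseteq> - D"
    by (rule openE)
  note m = this
  have m_le: "m \<le> norm x" if "x \<in> D" for x
  proof (rule ccontr)
    assume "\<not> m \<le> norm x"
    then have "x \<in> ball 0 m" by simp
    then show False using m(2) that by blast
  qed
  have "m * \<bar>t b\<bar> \<le> norm (\<Sum>b\<in>B. t b *\<^sub>R b)" if b: "b \<in> B" for t b
  proof -
    obtain a where a: "a \<in> B" "\<And>b. b \<in> B \<Longrightarrow> \<bar>t b\<bar> \<le> \<bar>t a\<bar>"
    proof -
      have "Max ((\<lambda>b. \<bar>t b\<bar>) ` B) \<in> (\<lambda>b. \<bar>t b\<bar>) ` B"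
        using assms(2) b by (intro Max_in) auto
      then obtain a where a: "Max ((\<lambda>b. \<bar>t b\<bar>) ` B) = \<bar>t a\<bar>" "a \<in> B"
        by (rule imageE)
      have "\<bar>t b\<bar> \<le> \<bar>t a\<bar>" if "b \<in> B" for b
        unfolding a(1)[symmetric] using assms(2) that by (intro Max_ge) auto
      then show ?thesis
        using a(2) by (rule that[rotated])
    qed
    show ?thesis
    proof (cases "t a = 0")
      case True
      then show ?thesis using a(2)[OF b] by simp
    next
      case False
      have "(\<Sum>b\<in>B. t b *\<^sub>R b) = t a *\<^sub>R (a + (\<Sum>b\<in>B - {a}. (t b / t a) *\<^sub>R b))"
        using False assms a(1) by (simp add: sum.remove[of B a] scaleR_add_right scaleR_sum_right)
      moreover have "a + (\<Sum>b\<in>B - {a}. (t b / t a) *\<^sub>R b) \<in> D"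
        using a False by (intro mem) auto
      ultimately have "\<bar>t a\<bar> * m \<le> norm (\<Sum>b\<in>B. t b *\<^sub>R b)"
        using m_le by (simp add: mult_left_mono)
      moreover have "m * \<bar>t b\<bar> \<le> \<bar>t a\<bar> * m"
        using a(2)[OF b] m(1) by (simp add: mult.commute)
      ultimately show ?thesis by linarith
    qed
  qed
  with m(1) that show ?thesis by blast
qed

text \<open>A grid point receives label \<open>0\<close> in direction \<open>i\<close> if it lies on the face \<open>x i = 0\<close> or next to a
  piece of colour \<open>i\<close> that meets this face. Each piece is too small to reach the opposite face, and
  around a grid point of colour \<open>i\<close> the label in direction \<open>i\<close> is constant, which contradicts
  Kuhn's combinatorial lemma.\<close>

lemma grid_colouring_large_piece:
  fixes k :: "(nat \<Rightarrow> nat) \<Rightarrow> nat" and p :: "(nat \<Rightarrow> nat) \<Rightarrow> 'b"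
  assumes k: "\<And>x. k x < n"
    and close: "\<And>x y. \<lbrakk>k x = k y; \<And>j. j < n \<Longrightarrow> x j \<le> y j + 2 \<and> y j \<le> x j + 2\<rbrakk> \<Longrightarrow> p x = p y"
    and small: "\<And>x y i. \<lbrakk>i < n; k x = k y; p x = p y; x i = 0\<rbrakk> \<Longrightarrow> y i < M"
  shows False
proof -
  define P where "P y i \<longleftrightarrow> k y = i \<and> (\<exists>z. z i = 0 \<and> k z = i \<and> p z = p y)" for y i
  have PI: "P y i" if "k y = i" "z i = 0" "k z = i" "p z = p y" for y z i
    using that unfolding P_def by (intro conjI exI[of _ z])
  have PE: "\<exists>z. z i = 0 \<and> k z = i \<and> p z = p y" "k y = i" if "P y i" for y i
    using that unfolding P_def by (rule conjunct2, rule conjunct1)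
  have P_small: "y i < M" if Py: "P y i" for y i
  proof -
    from PE(1)[OF Py] obtain z where "z i = 0 \<and> k z = i \<and> p z = p y" ..
    then show ?thesis
      using small[of i z y] PE(2)[OF Py] k[of y] by simp
  qed
  define nearby where "nearby x y \<longleftrightarrow> (\<forall>j<n. x j \<le> y j + 1 \<and> y j \<le> x j + (1::nat))" for x y
  define label where "label x i = (if x i = 0 \<or> (\<exists>y. P y i \<and> nearby x y) then 0 else 1::nat)" for x i
  \<comment> \<open>The grid ends at \<open>Suc M\<close>: where \<open>P\<close> holds the
    coordinate is below \<open>M\<close>, and being \<open>nearby\<close> adds at most one.\<close>
  have label_last: "label x i = 1" if "i < n" "x i = Suc M" for x i
  proof -
    have "\<not> nearby x y" if "P y i" for y
    proof
      assume "nearby x y"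
      then have "x i \<le> y i + 1" using \<open>i < n\<close> by (simp add: nearby_def)
      then show False using P_small[OF that] \<open>x i = Suc M\<close> by simp
    qed
    with that(2) show ?thesis unfolding label_def by simp
  qed
  have label1: "\<forall>x. (\<forall>i<n. x i \<le> Suc M) \<longrightarrow> (\<forall>i<n. label x i = 0 \<or> label x i = 1)"
    and label2: "\<forall>x. (\<forall>i<n. x i \<le> Suc M) \<longrightarrow> (\<forall>i<n. x i = 0 \<longrightarrow> label x i = 0)"
    by (simp_all add: label_def)
  have label3: "\<forall>x. (\<forall>i<n. x i \<le> Suc M) \<longrightarrow> (\<forall>i<n. x i = Suc M \<longrightarrow> label x i = 1)"
    by (intro allI impI label_last)
  obtain q where "\<forall>i<n. q i < Suc M" and q: "\<forall>i<n. \<exists>r r'. (\<forall>j<n. q j \<le> r j \<and> r j \<le> q j + 1) \<and>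
      (\<forall>j<n. q j \<le> r' j \<and> r' j \<le> q j + 1) \<and> label r i \<noteq> label r' i"
    by (rule kuhn_lemma[OF zero_less_Suc label1 label2 label3])
  \<comment> \<open>Kuhn's lemma gives a unit cell at \<open>q\<close> whose corners carry both
    labels in every direction. The direction to be contradicted is the colour of
    \<open>q\<close>.\<close>
  define i where "i = k q"
  have label_const: "label r i = (if P q i then 0 else 1)" if r: "\<forall>j<n. q j \<le> r j \<and> r j \<le> q j + 1" for r
  proof (cases "P q i")
    case True
    moreover have "nearby r q"
      unfolding nearby_def
    proof (intro allI impI)
      show "r j \<le> q j + 1 \<and> q j \<le> r j + 1" if "j < n" for j
        using r[rule_format, OF that] by simp
    qed
    ultimately have "\<exists>y. P y i \<and> nearby r y" by (intro exI[of _ q] conjI)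
    with True show ?thesis unfolding label_def by simp
  next
    case False
    \<comment> \<open>A corner on the face forces \<open>q i = 0\<close>, and then \<open>q\<close>
      itself would witness \<open>P q i\<close>.\<close>
    have "r i \<noteq> 0"
    proof
      assume "r i = 0"
      then have "q i = 0" using r[rule_format, of i] k[of q] by (simp add: i_def)
      then have "P q i" by (intro PI[of q i q]) (simp_all add: i_def)
      with False show False ..
    qed
    moreover have "\<not> (\<exists>y. P y i \<and> nearby r y)"
    proof (rule notI, elim exE conjE)
      fix y assume Py: "P y i" and y: "nearby r y"
      \<comment> \<open>One step from \<open>q\<close> to the corner \<open>r\<close> and one from
        \<open>r\<close> to \<open>y\<close> account for the 2 in the assumption
        \<open>close\<close>.\<close>
      have near: "q j \<le> y j + 2 \<and> y j \<le> q j + 2" if "j < n" for j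
        using y[unfolded nearby_def, rule_format, OF that] r[rule_format, OF that] by linarith
      have "k q = k y" using PE(2)[OF Py] by (simp add: i_def)
      then have pq: "p q = p y" using near by (rule close)
      from PE(1)[OF Py] obtain z where z: "z i = 0 \<and> k z = i \<and> p z = p y" ..
      then have "p z = p q" using pq by metis
      with z have "z i = 0 \<and> k z = i \<and> p z = p q" by blast
      then have "P q i" unfolding P_def by (intro conjI i_def[symmetric]) (rule exI)
      with False show False ..
    qed
    ultimately show ?thesis using False unfolding label_def by simp
  qed
  have "i < n" using k by (simp add: i_def)
  from q[rule_format, OF this] show False
  proof (elim exE conjE)
    fix r r' assume "\<forall>j<n. q j \<le> r j \<and> r j \<le> q j + 1" "\<forall>j<n. q j \<le> r' j \<and> r' j \<le> q j + 1"
      "label r i \<noteq> label r' i"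
    then show False
      using label_const[of r] label_const[of r'] by simp
  qed
qed

text \<open>The colouring is sampled on a fine grid. Separation by \<open>\<epsilon>\<close> becomes
  separation by two grid steps, and the coordinate bound turns the size \<open>K\<close> into a
  bound on the number of grid steps across a piece.\<close>

theorem span_not_colourable:
  fixes B :: "'a::real_normed_vector set"
  assumes B: "independent B" "finite B" and C: "finite C" "card C = card B"
  shows "\<not> colourable C (span B)"
proof
  define n where "n = card B"
  obtain \<beta> where \<beta>: "bij_betw \<beta> {..<n} B"
    using ex_bij_betw_nat_finite[OF B(2)] by (auto simp: n_def atLeast0LessThan)
  obtain e where e: "bij_betw e C {..<n}"
    using ex_bij_betw_finite_nat[OF C(1)] C(2) by (auto simp: n_def atLeast0LessThan)
  assume "colourable C (span B)"
  then obtain c p \<epsilon> K where "colouring C (span B) c p \<epsilon> K"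
    by (auto simp: colourable_def)
  note c = colouringD[OF this]
  obtain m where m: "m > 0" "\<And>t b. b \<in> B \<Longrightarrow> m * \<bar>t b\<bar> \<le> norm (\<Sum>b\<in>B. t b *\<^sub>R b)"
    using independent_coordinate_bound[OF B] by metis
  define N where "N = (\<Sum>i<n. norm (\<beta> i))"
  have "N \<ge> 0" by (simp add: N_def sum_nonneg)
  \<comment> \<open>With this mesh, moving two steps in every direction costs at most
    \<open>\<epsilon>\<close>; adding 1 to \<open>N\<close> keeps the denominator positive when
    \<open>B\<close> is empty.\<close>
  define s where "s = \<epsilon> / (2 * (N + 1))"
  have s: "s > 0" "2 * s * N \<le> \<epsilon>"
    using \<open>N \<ge> 0\<close> c(1) by (auto simp: s_def field_simps)
  define L where "L x = (\<Sum>i<n. (s * real (x i)) *\<^sub>R \<beta> i)" for x :: "nat \<Rightarrow> nat"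
  have L_span: "L x \<in> span B" for x
    unfolding L_def using \<beta> by (intro span_sum span_scale span_base) (auto dest: bij_betwE)
  have L_diff: "L x - L y = (\<Sum>i<n. (s * (real (x i) - real (y i))) *\<^sub>R \<beta> i)" for x y
    by (simp add: L_def algebra_simps flip: sum_subtractf)
  have L_coord: "m * s * \<bar>real (x i) - real (y i)\<bar> \<le> dist (L x) (L y)" if "i < n" for x y i
  proof -
    define t where "t b = s * (real (x (inv_into {..<n} \<beta> b)) - real (y (inv_into {..<n} \<beta> b)))" for b
    have t: "t (\<beta> j) = s * (real (x j) - real (y j))" if "j < n" for j
      using that \<beta> by (simp add: t_def bij_betw_inv_into_left)
    have "(\<Sum>b\<in>B. t b *\<^sub>R b) = (\<Sum>j<n. t (\<beta> j) *\<^sub>R \<beta> j)"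
      using sum.reindex_bij_betw[OF \<beta>, of "\<lambda>b. t b *\<^sub>R b"] by simp
    also have "\<dots> = L x - L y"
      unfolding L_diff using t by (intro sum.cong) auto
    finally have "m * \<bar>t (\<beta> i)\<bar> \<le> norm (L x - L y)"
      using m(2)[of "\<beta> i" t] \<beta> that by (auto dest: bij_betwE)
    then show ?thesis
      using t[OF that] s by (simp add: dist_norm abs_mult mult.assoc)
  qed
  have L_close: "dist (L x) (L y) \<le> \<epsilon>" if "\<And>j. j < n \<Longrightarrow> x j \<le> y j + 2 \<and> y j \<le> x j + 2" for x y
  proof -
    have "dist (L x) (L y) \<le> (\<Sum>j<n. norm ((s * (real (x j) - real (y j))) *\<^sub>R \<beta> j))"
      unfolding dist_norm L_diff by (rule norm_sum)
    also have "\<dots> \<le> (\<Sum>j<n. 2 * s * norm (\<beta> j))"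
    proof (rule sum_mono)
      fix j assume "j \<in> {..<n}"
      then have "\<bar>real (x j) - real (y j)\<bar> \<le> 2"
        using that[of j] by auto
      then have "s * \<bar>real (x j) - real (y j)\<bar> \<le> 2 * s"
        using s(1) by simp
      then have "s * \<bar>real (x j) - real (y j)\<bar> * norm (\<beta> j) \<le> 2 * s * norm (\<beta> j)"
        by (intro mult_right_mono) auto
      then show "norm ((s * (real (x j) - real (y j))) *\<^sub>R \<beta> j) \<le> 2 * s * norm (\<beta> j)"
        using s(1) by (simp add: abs_mult)
    qed
    also have "\<dots> = 2 * s * N"
      by (simp add: N_def sum_distrib_left)
    finally show ?thesis using s(2) by simp
  qed
  define k where "k x = e (c (L x))" for x
  have k: "k x < n" for x
    using c(2) L_span[of x] e by (auto simp: k_def dest!: bij_betwE)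
  have same: "c (L x) = c (L y)" if "k x = k y" for x y
    using that e c(2) L_span[of x] L_span[of y] unfolding k_def bij_betw_def
    by (metis image_subset_iff inj_onD)
  \<comment> \<open>A displacement of \<open>M\<close> steps in one coordinate already exceeds the
    diameter of a piece.\<close>
  obtain M where M: "m * s * real M > K"
  proof -
    obtain M where "K / (m * s) < real M" using reals_Archimedean2 by blast
    then have "m * s * real M > K"
      using m(1) s(1) by (simp add: field_simps)
    then show ?thesis by (rule that)
  qed
  show False
  proof (rule grid_colouring_large_piece[of k n "\<lambda>x. p (L x)" M])
    show "p (L x) = p (L y)" if "k x = k y" "\<And>j. j < n \<Longrightarrow> x j \<le> y j + 2 \<and> y j \<le> x j + 2" for x y
      using c(3)[OF L_span L_span same[OF that(1)]] L_close[OF that(2)] by simp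
  next
    fix x y i assume xy: "i < n" "k x = k y" "p (L x) = p (L y)" "x i = 0"
    have "m * s * real (y i) \<le> dist (L x) (L y)"
      using L_coord[of i x y] xy by simp
    also have "\<dots> \<le> K"
      using c(4)[OF L_span L_span same[OF xy(2)] xy(3)] .
    also have "\<dots> < m * s * real M" by (rule M)
    finally show "y i < M"
      using m(1) s(1) by simp
  qed (rule k)
qed

section \<open>The generalized gradient\<close>

text \<open>A real-valued substitute for the generalized directional derivative $f^0(x,v)$: the
  bound holds if $f^0(x,v) < a$, and it implies that $f^0(x,v)$ is at most \<open>a\<close>.\<close>

definition directional_bound :: "('a::real_normed_vector \<Rightarrow> real) \<Rightarrow> 'a \<Rightarrow> 'a \<Rightarrow> real \<Rightarrow> bool" where
  "directional_bound f x v a \<longleftrightarrow>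
     (\<exists>R>0. \<forall>y\<in>ball x R. \<forall>t. 0 < t \<and> t < R \<longrightarrow> f (y + t *\<^sub>R v) \<le> f y + a * t)"

lemma directional_boundI:
  assumes "R > 0" "S > 0"
    and "\<And>y t. \<lbrakk>dist x y < R; 0 < t; t < S\<rbrakk> \<Longrightarrow> f (y + t *\<^sub>R v) \<le> f y + a * t"
  shows "directional_bound f x v a"
  unfolding directional_bound_def using assms by (intro exI[of _ "min R S"]) auto

lemma directional_boundE:
  assumes "directional_bound f x v a"
  obtains R where "R > 0"
    "\<And>y t. \<lbrakk>dist x y < R; 0 < t; t < R\<rbrakk> \<Longrightarrow> f (y + t *\<^sub>R v) \<le> f y + a * t"
  using assms unfolding directional_bound_def by auto

lemma directional_bound_if_clarke_dderiv_less:
  assumes "clarke_dderiv f x v < ereal a"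
  shows "directional_bound f x v a"
proof -
  have "\<forall>\<^sub>F (y, \<mu>) in nhds x \<times>\<^sub>F at_right 0. (f (y + \<mu> *\<^sub>R v) - f y) / \<mu> < a"
    using Limsup_lessD[OF assms[unfolded clarke_dderiv_def]] by (simp add: case_prod_beta')
  then obtain P Q where P: "eventually P (nhds x)" and Q: "eventually Q (at_right (0::real))"
    and PQ: "\<And>y \<mu>. P y \<Longrightarrow> Q \<mu> \<Longrightarrow> (f (y + \<mu> *\<^sub>R v) - f y) / \<mu> < a"
    unfolding eventually_prod_filter by auto
  obtain R where R: "R > 0" "\<And>y. dist y x < R \<Longrightarrow> P y"
    using P unfolding eventually_nhds_metric by auto
  obtain S where S: "S > 0" "\<And>\<mu>. 0 < \<mu> \<Longrightarrow> \<mu> < S \<Longrightarrow> Q \<mu>"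
    using Q unfolding eventually_at_right_field by auto
  show ?thesis
  proof (rule directional_boundI[OF R(1) S(1)])
    fix y and t :: real assume "dist x y < R" "0 < t" "t < S"
    then have "(f (y + t *\<^sub>R v) - f y) / t < a"
      using R(2) S(2) by (intro PQ) (auto simp: dist_commute)
    then show "f (y + t *\<^sub>R v) \<le> f y + a * t"
      using \<open>0 < t\<close> by (simp add: field_simps)
  qed
qed

lemma clarke_dderiv_le_if_directional_bound:
  assumes "directional_bound f x v a"
  shows "clarke_dderiv f x v \<le> ereal a"
proof -
  obtain R where R: "R > 0"
    "\<And>y t. \<lbrakk>dist x y < R; 0 < t; t < R\<rbrakk> \<Longrightarrow> f (y + t *\<^sub>R v) \<le> f y + a * t"
    using directional_boundE[OF assms] by blast
  have "\<forall>\<^sub>F y in nhds x. dist x y < R"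
    using R(1) by (auto simp: eventually_nhds_metric dist_commute)
  moreover have "\<forall>\<^sub>F t in at_right (0::real). 0 < t \<and> t < R"
    using R(1) by (auto simp: eventually_at_right_field)
  moreover have "ereal ((f (y + t *\<^sub>R v) - f y) / t) \<le> ereal a" if "dist x y < R" "0 < t \<and> t < R" for y t
    using R(2)[of y t] that by (simp add: field_simps)
  ultimately have "\<forall>\<^sub>F p in nhds x \<times>\<^sub>F at_right (0::real).
      (case p of (y, t) \<Rightarrow> ereal ((f (y + t *\<^sub>R v) - f y) / t)) \<le> ereal a"
    unfolding eventually_prod_filter by fastforce
  then show ?thesis
    unfolding clarke_dderiv_def by (rule Limsup_bounded)
qed

text \<open>The generalized directional derivative is the infimum of the real bounds
  \<open>a\<close>; the converse direction picks a real number strictly between two extended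
  reals.\<close>

lemma mem_clarke_gradient_iff:
  "p \<in> clarke_gradient f x \<longleftrightarrow> (\<forall>v a. directional_bound f x v a \<longrightarrow> blinfun_apply p v \<le> a)"
proof (intro iffI allI impI)
  fix v a assume "p \<in> clarke_gradient f x" "directional_bound f x v a"
  then have "ereal (blinfun_apply p v) \<le> ereal a"
    using clarke_dderiv_le_if_directional_bound order_trans
    unfolding clarke_gradient_def by blast
  then show "blinfun_apply p v \<le> a" by simp
next
  assume *: "\<forall>v a. directional_bound f x v a \<longrightarrow> blinfun_apply p v \<le> a"
  have "ereal (blinfun_apply p v) \<le> clarke_dderiv f x v" for v
  proof (rule ccontr)
    assume "\<not> ?thesis"
    then obtain a where "clarke_dderiv f x v < ereal a" "ereal a < ereal (blinfun_apply p v)"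
      using ereal_dense2[of "clarke_dderiv f x v" "ereal (blinfun_apply p v)"] by (auto simp: not_le)
    then show False
      using directional_bound_if_clarke_dderiv_less * by fastforce
  qed
  then show "p \<in> clarke_gradient f x"
    by (simp add: clarke_gradient_def)
qed

lemma critical_point_iff:
  "critical_point f x \<longleftrightarrow> (\<forall>v a. directional_bound f x v a \<longrightarrow> 0 \<le> a)"
  by (simp add: critical_point_def mem_clarke_gradient_iff)

section \<open>Calculus of directional bounds\<close>

lemma directional_bound_mono:
  assumes "directional_bound f x v a" "a \<le> b"
  shows "directional_bound f x v b"
proof -
  obtain R where R: "R > 0"
    "\<And>y t. \<lbrakk>dist x y < R; 0 < t; t < R\<rbrakk> \<Longrightarrow> f (y + t *\<^sub>R v) \<le> f y + a * t"
    using directional_boundE[OF assms(1)] by blast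
  show ?thesis
  proof (rule directional_boundI[OF R(1) R(1)])
    fix y t assume "dist x y < R" "0 < t" "t < R"
    then have "f (y + t *\<^sub>R v) \<le> f y + a * t" "a * t \<le> b * t"
      using R(2) assms(2) by (auto intro: mult_right_mono)
    then show "f (y + t *\<^sub>R v) \<le> f y + b * t" by linarith
  qed
qed

text \<open>This is the upper semicontinuity of the generalized directional derivative in the base
  point, which makes limits of almost critical points critical.\<close>

lemma directional_bound_nearby:
  assumes "directional_bound f x v a"
  obtains R where "R > 0" "\<And>y. dist x y < R \<Longrightarrow> directional_bound f y v a"
proof -
  obtain R where R: "R > 0"
    "\<And>y t. \<lbrakk>dist x y < R; 0 < t; t < R\<rbrakk> \<Longrightarrow> f (y + t *\<^sub>R v) \<le> f y + a * t"
    using directional_boundE[OF assms] by blast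
  have "directional_bound f y v a" if "dist x y < R / 2" for y
  proof (rule directional_boundI[of "R / 2" R])
    fix w t assume "dist y w < R / 2" "0 < t" "t < R"
    then show "f (w + t *\<^sub>R v) \<le> f w + a * t"
      using dist_triangle[of x w y] that by (intro R(2)) auto
  qed (use R(1) in auto)
  with R(1) show ?thesis by (intro that[of "R / 2"]) auto
qed

lemma directional_bound_translate:
  assumes "periodic_wrt Z f" "z \<in> Z" "directional_bound f x v a"
  shows "directional_bound f (x + z) v a"
proof -
  obtain R where R: "R > 0"
    "\<And>y t. \<lbrakk>dist x y < R; 0 < t; t < R\<rbrakk> \<Longrightarrow> f (y + t *\<^sub>R v) \<le> f y + a * t"
    using directional_boundE[OF assms(3)] by blast
  have per: "f w = f (w - z)" for w
    using assms(1,2) unfolding periodic_wrt_def by (metis diff_add_cancel)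
  show ?thesis
  proof (rule directional_boundI[OF R(1) R(1)])
    fix y t assume "dist (x + z) y < R" "0 < t" "t < R"
    then have "f (y - z + t *\<^sub>R v) \<le> f (y - z) + a * t"
      by (intro R(2)) (auto simp: dist_norm algebra_simps)
    then show "f (y + t *\<^sub>R v) \<le> f y + a * t"
      using per[of y] per[of "y + t *\<^sub>R v"] by (simp add: algebra_simps)
  qed
qed

lemma directional_bound_zero_iff: "directional_bound f x 0 a \<longleftrightarrow> a \<ge> 0"
proof
  assume "directional_bound f x 0 a"
  then obtain R where R: "R > 0"
    "\<And>y t. \<lbrakk>dist x y < R; 0 < t; t < R\<rbrakk> \<Longrightarrow> f (y + t *\<^sub>R 0) \<le> f y + a * t"
    using directional_boundE by blast
  then show "a \<ge> 0"
    using R(2)[of x "R / 2"] by (simp add: zero_le_mult_iff)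
qed (auto intro!: directional_boundI[of 1 1])

text \<open>A step along \<open>v + w\<close> is a step along \<open>w\<close> followed by one along
  \<open>v\<close>. The second starts at a moved base point, so the step must be short enough to
  keep that point in the ball of radius \<open>R\<close>.\<close>

lemma directional_bound_add:
  assumes "directional_bound f x v a" "directional_bound f x w b"
  shows "directional_bound f x (v + w) (a + b)"
proof -
  obtain R where R: "R > 0"
    "\<And>y t. \<lbrakk>dist x y < R; 0 < t; t < R\<rbrakk> \<Longrightarrow> f (y + t *\<^sub>R v) \<le> f y + a * t"
    using directional_boundE[OF assms(1)] by blast
  obtain S where S: "S > 0"
    "\<And>y t. \<lbrakk>dist x y < S; 0 < t; t < S\<rbrakk> \<Longrightarrow> f (y + t *\<^sub>R w) \<le> f y + b * t"
    using directional_boundE[OF assms(2)] by blast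
  let ?T = "min (min R S) (R / (2 * (norm w + 1)))"
  show ?thesis
  proof (rule directional_boundI[of "min (R / 2) S" ?T])
    fix y t assume y: "dist x y < min (R / 2) S" and t: "0 < t" "t < ?T"
    have "t * norm w \<le> t * (norm w + 1)"
      using t by simp
    also have "\<dots> < R / 2"
      using t by (simp add: field_simps add_pos_nonneg)
    finally have "dist y (y + t *\<^sub>R w) < R / 2"
      using t by (simp add: dist_norm)
    then have "dist x (y + t *\<^sub>R w) < R"
      using y dist_triangle[of x "y + t *\<^sub>R w" y] by simp
    then have "f (y + t *\<^sub>R w + t *\<^sub>R v) \<le> f (y + t *\<^sub>R w) + a * t"
      using t by (intro R(2)) auto
    moreover have "f (y + t *\<^sub>R w) \<le> f y + b * t"
      using y t by (intro S(2)) auto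
    ultimately show "f (y + t *\<^sub>R (v + w)) \<le> f y + (a + b) * t"
      by (simp add: algebra_simps)
  qed (use R(1) S(1) in \<open>auto intro!: divide_pos_pos add_nonneg_pos\<close>)
qed

lemma directional_bound_scaleR:
  assumes "directional_bound f x v a" "s > 0"
  shows "directional_bound f x (s *\<^sub>R v) (s * a)"
proof -
  obtain R where R: "R > 0"
    "\<And>y t. \<lbrakk>dist x y < R; 0 < t; t < R\<rbrakk> \<Longrightarrow> f (y + t *\<^sub>R v) \<le> f y + a * t"
    using directional_boundE[OF assms(1)] by blast
  show ?thesis
  proof (rule directional_boundI[of R "R / s"])
    fix y t assume "dist x y < R" "0 < t" "t < R / s"
    then have "f (y + (t * s) *\<^sub>R v) \<le> f y + a * (t * s)"
      using assms(2) by (intro R(2)) (auto simp: field_simps)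
    then show "f (y + t *\<^sub>R s *\<^sub>R v) \<le> f y + s * a * t"
      by (simp add: mult.commute mult.left_commute)
  qed (use R(1) assms(2) in auto)
qed

text \<open>Equivalent to $f^0(x,v)$ being at least \<open>- \<sigma> * norm v\<close> for all
  \<open>v\<close>. For nonnegative \<open>\<sigma>\<close> this is the primal counterpart of a
  gradient element of norm at most \<open>\<sigma>\<close>.\<close>

definition descent_rate_le :: "('a::real_normed_vector \<Rightarrow> real) \<Rightarrow> 'a \<Rightarrow> real \<Rightarrow> bool" where
  "descent_rate_le f x \<sigma> \<longleftrightarrow> (\<forall>v a. directional_bound f x v a \<longrightarrow> - \<sigma> * norm v \<le> a)"

lemma descent_direction:
  assumes "\<not> descent_rate_le f x \<sigma>" "\<sigma> \<ge> 0"
  obtains v where "norm v = 1" "directional_bound f x v (- \<sigma>)"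
proof -
  obtain v a where v: "directional_bound f x v a" "a < - \<sigma> * norm v"
    using assms(1) by (auto simp: descent_rate_le_def not_le)
  have "v \<noteq> 0"
    using v directional_bound_zero_iff by force
  have "directional_bound f x (inverse (norm v) *\<^sub>R v) (inverse (norm v) * a)"
    using v(1) \<open>v \<noteq> 0\<close> by (intro directional_bound_scaleR) auto
  moreover have "inverse (norm v) * a \<le> - \<sigma>"
    using v(2) \<open>v \<noteq> 0\<close> by (simp add: field_simps)
  ultimately have "directional_bound f x (inverse (norm v) *\<^sub>R v) (- \<sigma>)"
    by (rule directional_bound_mono)
  moreover have "norm (inverse (norm v) *\<^sub>R v) = 1"
    using \<open>v \<noteq> 0\<close> by simp
  ultimately show ?thesis by (intro that)
qed

text \<open>The functional to which the Hahn-Banach theorem is applied is the infimal convolution of the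
  generalized directional derivative and the multiple \<open>\<sigma>\<close> of the norm.\<close>

lemma min_gradient_norm_le:
  assumes "descent_rate_le f x \<sigma>" "\<sigma> \<ge> 0"
  shows "0 \<le> min_gradient_norm f x \<and> min_gradient_norm f x \<le> \<sigma>"
proof -
  define T where "T = {(w, a). directional_bound f x w a}"
  define q where "q v = (INF (w, a)\<in>T. a + \<sigma> * norm (v - w))" for v
  \<comment> \<open>Here the descent rate enters: it keeps the infimum \<open>q v\<close>
    finite.\<close>
  have lb: "- \<sigma> * norm v \<le> a + \<sigma> * norm (v - w)" if "(w, a) \<in> T" for v w a
  proof -
    have "- \<sigma> * norm w \<le> a"
      using assms(1) that by (auto simp: T_def descent_rate_le_def)
    moreover have "\<sigma> * norm w \<le> \<sigma> * (norm v + norm (v - w))"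
      using assms(2) norm_triangle_sub[of w v] by (intro mult_left_mono) (auto simp: norm_minus_commute)
    ultimately show ?thesis by (simp add: algebra_simps)
  qed
  have low: "q v \<le> a + \<sigma> * norm (v - w)" if "(w, a) \<in> T" for v w a
    unfolding q_def using that lb[of _ _ v]
    by (intro cINF_lower2[OF bdd_belowI2[of _ "- \<sigma> * norm v"] that]) auto
  have T0: "(0, 0) \<in> T"
    by (simp add: T_def directional_bound_zero_iff)
  have great: "c \<le> q v" if "\<And>w a. (w, a) \<in> T \<Longrightarrow> c \<le> a + \<sigma> * norm (v - w)" for c v
    unfolding q_def using T0 that by (intro cINF_greatest) auto
  have "sublinear q"
  proof (rule sublinearI)
    fix v v'
    have *: "q (v + v') \<le> (a + \<sigma> * norm (v - w)) + (a' + \<sigma> * norm (v' - w'))"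
      if "(w, a) \<in> T" "(w', a') \<in> T" for w a w' a'
    proof -
      have "(w + w', a + a') \<in> T"
        using that by (auto simp: T_def intro: directional_bound_add)
      then have "q (v + v') \<le> (a + a') + \<sigma> * norm (v + v' - (w + w'))"
        by (rule low)
      also have "\<sigma> * norm (v + v' - (w + w')) \<le> \<sigma> * (norm (v - w) + norm (v' - w'))"
        using assms(2) norm_triangle_ineq[of "v - w" "v' - w'"]
        by (intro mult_left_mono) (auto simp: algebra_simps)
      finally show ?thesis by (simp add: algebra_simps)
    qed
    have "q (v + v') - (a' + \<sigma> * norm (v' - w')) \<le> q v" if "(w', a') \<in> T" for w' a'
      using *[OF _ that] by (intro great) (simp add: algebra_simps)
    then have "q (v + v') - q v \<le> q v'"
      by (intro great) (simp add: algebra_simps)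
    then show "q (v + v') \<le> q v + q v'" by simp
  next
    fix t :: real and v assume t: "t > 0"
    have "q (t *\<^sub>R v) / t \<le> a + \<sigma> * norm (v - w)" if "(w, a) \<in> T" for w a
    proof -
      have "(t *\<^sub>R w, t * a) \<in> T"
        using that t by (auto simp: T_def intro: directional_bound_scaleR)
      then have "q (t *\<^sub>R v) \<le> t * a + \<sigma> * norm (t *\<^sub>R v - t *\<^sub>R w)"
        by (rule low)
      also have "norm (t *\<^sub>R v - t *\<^sub>R w) = t * norm (v - w)"
        using t by (simp flip: scaleR_diff_right)
      finally show ?thesis
        using t by (simp add: field_simps)
    qed
    then have "q (t *\<^sub>R v) / t \<le> q v" by (rule great)
    then show "q (t *\<^sub>R v) \<le> t * q v"
      using t by (simp add: field_simps)
  qed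
  then obtain p where p: "linear p" "\<And>v. p v \<le> q v"
    using Hahn_Banach_sublinear by blast
  \<comment> \<open>The pair \<open>(0, 0)\<close> in \<open>T\<close> bounds \<open>p\<close> by
    \<open>\<sigma>\<close> times the norm, while pairs with \<open>w = v\<close> put
    \<open>p\<close> into the gradient.\<close>
  have up: "p v \<le> \<sigma> * norm v" for v
    using p(2)[of v] low[OF T0, of v] by simp
  have abs: "\<bar>p v\<bar> \<le> \<sigma> * norm v" for v
    using up[of v] up[of "- v"] linear_neg[OF p(1), of v] by simp
  have bl: "bounded_linear p"
    using p(1) abs
    by (intro bounded_linear_intro[of p \<sigma>]) (auto simp: linear_add linear_scale mult.commute)
  define P where "P = Blinfun p"
  have P: "blinfun_apply P = p"
    using bl by (simp add: P_def bounded_linear_Blinfun_apply)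
  have "p v \<le> a" if "directional_bound f x v a" for v a
    using p(2)[of v] low[of v a v] that by (simp add: T_def)
  then have mem: "P \<in> clarke_gradient f x"
    by (simp add: mem_clarke_gradient_iff P)
  have "norm P \<le> \<sigma>"
    using abs assms(2) by (intro norm_blinfun_bound) (auto simp: P)
  moreover have "bdd_below (norm ` clarke_gradient f x)"
    by (intro bdd_belowI2[of _ 0]) auto
  ultimately have "min_gradient_norm f x \<le> \<sigma>"
    unfolding min_gradient_norm_def by (intro cINF_lower2[OF _ mem])
  \<comment> \<open>The gradient contains \<open>P\<close>, so the infimum is not taken over the
    empty set.\<close>
  moreover have "0 \<le> min_gradient_norm f x"
    unfolding min_gradient_norm_def using mem by (intro cINF_greatest) auto
  ultimately show ?thesis by simp
qed

text \<open>The descent rates bound the minimal gradient norms, so the Palais-Smale condition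
  applies. Continuity of \<open>f\<close> gives the level of the limit, and semicontinuity of the
  directional bounds gives its criticality.\<close>

lemma PS_condition_critical_limit:
  assumes Z: "additive_subgroup Z" and f: "continuous_on UNIV f" "periodic_wrt Z f" "PS_condition Z f"
    and x: "(\<lambda>k. f (x k)) \<longlonglongrightarrow> c"
    and \<sigma>: "\<sigma> \<longlonglongrightarrow> 0" "\<And>k. \<sigma> k \<ge> 0" "\<And>k. descent_rate_le f (x k) (\<sigma> k)"
  obtains y r z where "critical_point f y" "f y = c" "\<And>k. z k \<in> Z"
    "(\<lambda>k. x (r k) - z k) \<longlonglongrightarrow> y" "strict_mono r"
proof -
  have neg: "- z \<in> Z" if "z \<in> Z" for z
    using Z that by (auto simp: additive_subgroup_def)
  have "Z \<noteq> {}"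
    using Z by (auto simp: additive_subgroup_def)
  have "(\<lambda>k. min_gradient_norm f (x k)) \<longlonglongrightarrow> 0"
    using min_gradient_norm_le[OF \<sigma>(3,2)]
    by (intro real_tendsto_sandwich[OF _ _ tendsto_const \<sigma>(1)]) auto
  moreover have "bounded (range (\<lambda>k. f (x k)))"
    using x by (rule convergent_imp_bounded)
  ultimately obtain r A where r: "strict_mono r" and "A \<in> range (coset_map Z)"
    and A: "(\<lambda>k. quotient_dist Z (coset_map Z (x (r k))) A) \<longlonglongrightarrow> 0"
    using f(3) unfolding PS_condition_def by blast
  then obtain y where "A = coset_map Z y" by auto
  \<comment> \<open>The quotient distance is only an infimum, so \<open>z k\<close> is chosen to
    attain it up to \<open>inverse (real (Suc k))\<close>.\<close>
  define I where "I k = (INF z\<in>Z. norm (x (r k) - y - z))" for k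
  have I: "I \<longlonglongrightarrow> 0"
    using A quotient_dist_coset_map[OF Z] by (simp add: \<open>A = _\<close> I_def[abs_def])
  have "\<exists>z\<in>Z. norm (x (r k) - y - z) < I k + inverse (real (Suc k))" for k
    using cInf_lessD[of "(\<lambda>z. norm (x (r k) - y - z)) ` Z" "I k + inverse (real (Suc k))"] \<open>Z \<noteq> {}\<close>
    by (auto simp: I_def)
  then obtain z where z: "\<And>k. z k \<in> Z" "\<And>k. norm (x (r k) - y - z k) < I k + inverse (real (Suc k))"
    by metis
  have I': "(\<lambda>k. I k + inverse (real (Suc k))) \<longlonglongrightarrow> 0"
    using tendsto_add[OF I LIMSEQ_inverse_real_of_nat] by simp
  have "(\<lambda>k. x (r k) - y - z k) \<longlonglongrightarrow> 0"
  proof (rule Lim_null_comparison[OF _ I'])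
    show "\<forall>\<^sub>F k in sequentially. norm (x (r k) - y - z k) \<le> I k + inverse (real (Suc k))"
      by (intro always_eventually allI less_imp_le z(2))
  qed
  then have lim: "(\<lambda>k. x (r k) - z k) \<longlonglongrightarrow> y"
    using LIM_zero_iff[of "\<lambda>k. x (r k) - z k" y] by (simp add: algebra_simps)
  have fz: "f (w - z k) = f w" for w k
    using f(2)[unfolded periodic_wrt_def, rule_format, OF neg[OF z(1)[of k]], of w] by simp
  have "(\<lambda>k. f (x (r k) - z k)) \<longlonglongrightarrow> f y"
    using f(1) lim by (auto intro: continuous_on_tendsto_compose)
  moreover have "(\<lambda>k. f (x (r k))) \<longlonglongrightarrow> c"
    using LIMSEQ_subseq_LIMSEQ[OF x r] by (simp add: o_def)
  ultimately have "f y = c"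
    by (simp add: fz LIMSEQ_unique)
  moreover have "critical_point f y"
    unfolding critical_point_iff
  proof (intro allI impI)
    \<comment> \<open>A bound at \<open>y\<close> persists near \<open>y\<close>, hence at the
      translated sequence and by periodicity at \<open>x (r k)\<close>; there it is at least
      \<open>- \<sigma> (r k) * norm v\<close>, which tends to 0.\<close>
    fix v a assume "directional_bound f y v a"
    then obtain R where R: "R > 0" "\<And>w. dist y w < R \<Longrightarrow> directional_bound f w v a"
      using directional_bound_nearby by blast
    have "\<forall>\<^sub>F k in sequentially. - \<sigma> (r k) * norm v \<le> a"
      using tendstoD[OF lim R(1)]
    proof eventually_elim
      case (elim k)
      then have "directional_bound f (x (r k) - z k) v a"
        by (intro R(2)) (simp add: dist_commute)
      then have "directional_bound f (x (r k)) v a"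
        using directional_bound_translate[OF f(2) z(1)[of k], of "x (r k) - z k" v a] by simp
      then show ?case
        using \<sigma>(3)[of "r k"] by (simp add: descent_rate_le_def)
    qed
    moreover have "(\<lambda>k. - \<sigma> (r k) * norm v) \<longlonglongrightarrow> - 0 * norm v"
      using LIMSEQ_subseq_LIMSEQ[OF \<sigma>(1) r] by (intro tendsto_intros) (simp add: o_def)
    ultimately show "0 \<le> a"
      using tendsto_upperbound[of "\<lambda>k. - \<sigma> (r k) * norm v" "- 0 * norm v" sequentially a] by simp
  qed
  ultimately show ?thesis
    using z(1) lim r by (intro that[of y z r])
qed

section \<open>Equivariant perturbations of the identity\<close>

text \<open>Only \<open>q\<close> is confined to \<open>K\<close>. In a sequence of counterexamples
  the points \<open>q\<close> subconverge in \<open>K\<close>, and the points \<open>u\<close>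
  converge to the same limit, against continuity there.\<close>

lemma uniformly_continuous_near_compact:
  fixes g :: "'a::metric_space \<Rightarrow> 'b::metric_space"
  assumes "compact K" "continuous_on UNIV g" "e > 0"
  obtains \<epsilon> where "\<epsilon> > 0" "\<And>q u. q \<in> K \<Longrightarrow> dist q u \<le> \<epsilon> \<Longrightarrow> dist (g q) (g u) < e"
proof (rule ccontr)
  assume "\<not> thesis"
  then have "\<not> (\<forall>q u. q \<in> K \<longrightarrow> dist q u \<le> inverse (real (Suc k)) \<longrightarrow> dist (g q) (g u) < e)" for k
    using that[of "inverse (real (Suc k))"] by auto
  then have "\<exists>q u. q \<in> K \<and> dist q u \<le> inverse (real (Suc k)) \<and> e \<le> dist (g q) (g u)" for k
    by (simp add: not_less)
  then obtain q u where qu: "\<And>k. q k \<in> K" "\<And>k. dist (q k) (u k) \<le> inverse (real (Suc k))"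
    "\<And>k. e \<le> dist (g (q k)) (g (u k))"
    by metis
  obtain l r where l: "l \<in> K" "strict_mono r" "(q \<circ> r) \<longlonglongrightarrow> l"
    using assms(1) qu(1) unfolding compact_def by blast
  have q: "(\<lambda>k. q (r k)) \<longlonglongrightarrow> l"
    using l(3) by (simp add: o_def)
  have inv: "(\<lambda>k. inverse (real (Suc (r k)))) \<longlonglongrightarrow> 0"
    using LIMSEQ_subseq_LIMSEQ[OF LIMSEQ_inverse_real_of_nat l(2)] by (simp add: o_def)
  have qu0: "(\<lambda>k. dist (q (r k)) (u (r k))) \<longlonglongrightarrow> 0"
    by (rule real_tendsto_sandwich[OF _ _ tendsto_const inv]) (simp_all add: qu(2) del: of_nat_Suc)
  have "(\<lambda>k. dist (q (r k)) (u (r k)) + dist (q (r k)) l) \<longlonglongrightarrow> 0"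
    using tendsto_add[OF qu0 q[THEN tendsto_dist_iff[THEN iffD1]]] by simp
  then have "(\<lambda>k. dist (u (r k)) l) \<longlonglongrightarrow> 0"
    by (rule real_tendsto_sandwich[OF _ _ tendsto_const, rotated 2])
      (simp_all add: dist_triangle3)
  then have u: "(\<lambda>k. u (r k)) \<longlonglongrightarrow> l"
    by (rule tendsto_dist_iff[THEN iffD2])
  have "(\<lambda>k. dist (g (q (r k))) (g (u (r k)))) \<longlonglongrightarrow> dist (g l) (g l)"
    using q u by (intro tendsto_dist continuous_on_tendsto_compose[OF assms(2)]) auto
  then have "e \<le> dist (g l) (g l)"
    using qu(3) by (intro LIMSEQ_le_const) auto
  with assms(3) show False by simp
qed

text \<open>The moves are made one after another. Each starts within \<open>\<epsilon>\<close> of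
  \<open>y\<close> because the total length is below \<open>\<epsilon>\<close>. Only directions of
  positive weight carry a descent estimate, which fits weights of small support.\<close>

lemma successive_descent:
  fixes f :: "'a::real_normed_vector \<Rightarrow> real"
  assumes "finite F" "\<And>u. u \<in> F \<Longrightarrow> 0 \<le> \<tau> u" "\<And>u. u \<in> F \<Longrightarrow> norm (v u) \<le> 1" "(\<Sum>u\<in>F. \<tau> u) < \<epsilon>"
    and "\<And>u w s. \<lbrakk>u \<in> F; 0 < \<tau> u; dist y w < \<epsilon>; 0 < s; s < \<epsilon>\<rbrakk> \<Longrightarrow> f (w + s *\<^sub>R v u) \<le> f w - \<sigma> * s"
  shows "f (y + (\<Sum>u\<in>F. \<tau> u *\<^sub>R v u)) \<le> f y - \<sigma> * (\<Sum>u\<in>F. \<tau> u)"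
  using assms
proof (induction F)
  case (insert u F)
  have nonneg: "0 \<le> (\<Sum>u\<in>F. \<tau> u)" "0 \<le> \<tau> u"
    using insert.prems(1) by (auto intro: sum_nonneg)
  have less: "(\<Sum>u\<in>F. \<tau> u) < \<epsilon>" "\<tau> u < \<epsilon>"
    using insert.prems(3) insert.hyps nonneg by simp_all
  let ?w = "y + (\<Sum>u\<in>F. \<tau> u *\<^sub>R v u)"
  have IH: "f ?w \<le> f y - \<sigma> * (\<Sum>u\<in>F. \<tau> u)"
    using insert.prems less(1) by (intro insert.IH) auto
  show ?case
  proof (cases "\<tau> u = 0")
    case True
    then show ?thesis using IH insert.hyps by simp
  next
    case False
    have "norm (\<Sum>u\<in>F. \<tau> u *\<^sub>R v u) \<le> (\<Sum>u\<in>F. \<tau> u)"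
    proof (rule sum_norm_le)
      fix a assume "a \<in> F"
      then show "norm (\<tau> a *\<^sub>R v a) \<le> \<tau> a"
        using insert.prems(1)[of a] insert.prems(2)[of a] by (simp add: mult_left_le)
    qed
    then have "dist y ?w < \<epsilon>"
      using less by (simp add: dist_norm)
    then have "f (?w + \<tau> u *\<^sub>R v u) \<le> f ?w - \<sigma> * \<tau> u"
      using False nonneg less by (intro insert.prems(4)) auto
    moreover have "y + (\<Sum>u\<in>insert u F. \<tau> u *\<^sub>R v u) = ?w + \<tau> u *\<^sub>R v u"
      using insert.hyps by (simp add: algebra_simps)
    ultimately show ?thesis
      using IH insert.hyps by (simp add: algebra_simps)
  qed
qed simp

lemma mem_orbit_iff:
  assumes "additive_subgroup Z"
  shows "y \<in> coset_map Z -` {coset_map Z x} \<longleftrightarrow> y - x \<in> Z"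
proof -
  have Z: "0 \<in> Z" "\<And>a b. a \<in> Z \<Longrightarrow> b \<in> Z \<Longrightarrow> a + b \<in> Z" "\<And>a. a \<in> Z \<Longrightarrow> - a \<in> Z"
    using assms by (auto simp: additive_subgroup_def)
  have sub: "coset_map Z a \<subseteq> coset_map Z b" if "a - b \<in> Z" for a b
  proof
    fix w assume "w \<in> coset_map Z a"
    then obtain z where "z \<in> Z" "w = a + z" by (auto simp: coset_map_def)
    then have "w = b + ((a - b) + z)" "(a - b) + z \<in> Z"
      using Z(2)[OF that] by simp_all
    then show "w \<in> coset_map Z b" unfolding coset_map_def by blast
  qed
  have "y - x \<in> Z" if "coset_map Z y = coset_map Z x"
  proof -
    have "y + 0 \<in> coset_map Z y" using Z(1) unfolding coset_map_def by blast
    then show ?thesis using that by (auto simp: coset_map_def)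
  qed
  moreover have "coset_map Z y = coset_map Z x" if "y - x \<in> Z"
    using sub[OF that] sub[of x y] Z(3)[OF that] by simp
  ultimately show ?thesis by auto
qed

text \<open>\<open>d\<close> is a gap between elements of \<open>Z\<close>. \<open>Q\<close> is a
  compact set whose \<open>Z\<close>-translates cover the sets under consideration; it becomes
  \<open>cube B\<close> in the end.\<close>

locale periodic_functional =
  fixes f :: "'a::banach \<Rightarrow> real" and Z Q :: "'a set" and d m :: real
  assumes Z: "additive_subgroup Z"
    and d_pos: "d > 0" and d_le: "\<And>z. z \<in> Z \<Longrightarrow> z \<noteq> 0 \<Longrightarrow> d \<le> norm z"
    and f_cont: "continuous_on UNIV f" and f_periodic: "periodic_wrt Z f"
    and f_PS: "PS_condition Z f" and f_ge: "\<And>x. m \<le> f x"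
    and Q: "compact Q"
begin

section \<open>Invariance under \<open>Z\<close> and the complete space of periodic
  perturbations\<close>

lemma Z_zero: "0 \<in> Z" and Z_add: "x \<in> Z \<Longrightarrow> y \<in> Z \<Longrightarrow> x + y \<in> Z" and Z_minus: "x \<in> Z \<Longrightarrow> - x \<in> Z"
  using Z by (auto simp: additive_subgroup_def)

lemma Z_diff: "x \<in> Z \<Longrightarrow> y \<in> Z \<Longrightarrow> x - y \<in> Z"
  using Z_add[of x "- y"] Z_minus[of y] by simp

lemma f_add: "z \<in> Z \<Longrightarrow> f (x + z) = f x"
  using f_periodic by (simp add: periodic_wrt_def)

lemma f_diff: "z \<in> Z \<Longrightarrow> f (x - z) = f x"
  using f_add[OF Z_minus, of z x] by simp

text \<open>Every point of such a set is a translate of a point of the compact set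
  \<open>A \<inter> Q\<close>, although \<open>A\<close> itself may be unbounded.\<close>

definition cocompact :: "'a set \<Rightarrow> bool" where
  "cocompact A \<longleftrightarrow> compact (A \<inter> Q) \<and> (\<forall>u\<in>A. \<forall>z\<in>Z. u + z \<in> A) \<and> (\<forall>u\<in>A. \<exists>z\<in>Z. u - z \<in> Q)"

definition perturbations :: "('a \<Rightarrow>\<^sub>C 'a) set" where
  "perturbations = {h :: 'a \<Rightarrow>\<^sub>C 'a. \<forall>u. \<forall>z\<in>Z. h (u + z) = h u}"

definition height :: "'a set \<Rightarrow> ('a \<Rightarrow>\<^sub>C 'a) \<Rightarrow> real" where
  "height A h = (SUP u\<in>A. f (u + h u))"

lemma perturbation_add: "h \<in> perturbations \<Longrightarrow> z \<in> Z \<Longrightarrow> h (u + z) = h u"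
  by (simp add: perturbations_def)

lemma perturbation_diff: "h \<in> perturbations \<Longrightarrow> z \<in> Z \<Longrightarrow> h (u - z) = h u"
  using perturbation_add[of h "- z" u] Z_minus[of z] by simp

lemma perturbation_cont: "continuous_on UNIV (\<lambda>u. u + apply_bcontfun h u)" for h :: "'a \<Rightarrow>\<^sub>C 'a"
  by (intro continuous_intros continuous_on_apply_bcontfun)

lemma f_perturbation_cont: "continuous_on UNIV (\<lambda>u. f (u + apply_bcontfun h u))" for h :: "'a \<Rightarrow>\<^sub>C 'a"
  by (rule continuous_on_compose2[OF f_cont perturbation_cont]) simp

lemma f_perturbation_diff:
  assumes "h \<in> perturbations" "z \<in> Z"
  shows "f (u - z + h (u - z)) = f (u + h u)"
proof -
  have "u - z + h (u - z) = (u + h u) - z"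
    unfolding perturbation_diff[OF assms] by simp
  then show ?thesis by (simp only: f_diff[OF assms(2)])
qed

lemma cocompactE:
  assumes "cocompact A" "u \<in> A"
  obtains z where "z \<in> Z" "u - z \<in> A \<inter> Q"
proof -
  obtain z where "z \<in> Z" "u - z \<in> Q"
    using assms unfolding cocompact_def by blast
  moreover have "u + - z \<in> A"
    using assms Z_minus[OF \<open>z \<in> Z\<close>] unfolding cocompact_def by blast
  ultimately show ?thesis using that by simp
qed

text \<open>The function \<open>u \<mapsto> f (u + h u)\<close> is invariant under \<open>Z\<close>,
  so its supremum over \<open>A\<close> is a supremum over the compact set
  \<open>A \<inter> Q\<close>.\<close>

lemma height_attained:
  assumes A: "cocompact A" "A \<noteq> {}" and h: "h \<in> perturbations"
  obtains u where "u \<in> A" "height A h = f (u + h u)" "\<And>v. v \<in> A \<Longrightarrow> f (v + h v) \<le> height A h"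
proof -
  have "compact (A \<inter> Q)" "A \<inter> Q \<noteq> {}"
  proof -
    show "compact (A \<inter> Q)" using A by (simp add: cocompact_def)
    obtain u where "u \<in> A" using A(2) by blast
    then show "A \<inter> Q \<noteq> {}" using cocompactE[OF A(1)] by blast
  qed
  then obtain u where u: "u \<in> A \<inter> Q" "\<And>v. v \<in> A \<inter> Q \<Longrightarrow> f (v + h v) \<le> f (u + h u)"
    using continuous_attains_sup[OF _ _ continuous_on_subset[OF f_perturbation_cont subset_UNIV]] by metis
  have le: "f (v + h v) \<le> f (u + h u)" if v: "v \<in> A" for v
  proof -
    obtain z where "z \<in> Z" "v - z \<in> A \<inter> Q"
      using cocompactE[OF A(1) v] .
    then show ?thesis
      using u(2)[of "v - z"] f_perturbation_diff[OF h] by simp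
  qed
  have "height A h = f (u + h u)"
    unfolding height_def using u(1) le by (intro cSup_eq_maximum) auto
  with u(1) le show ?thesis by (intro that[of u]) auto
qed

lemma f_le_height:
  assumes "cocompact A" "h \<in> perturbations" "u \<in> A"
  shows "f (u + h u) \<le> height A h"
  using assms by (auto intro: height_attained[of A h])

lemma complete_perturbations: "complete perturbations"
proof -
  have "closed perturbations"
    unfolding closed_sequential_limits
  proof (intro allI impI)
    fix h :: "nat \<Rightarrow> 'a \<Rightarrow>\<^sub>C 'a" and l
    assume h: "(\<forall>k. h k \<in> perturbations) \<and> h \<longlonglongrightarrow> l"
    then have lim: "(\<lambda>k. h k u) \<longlonglongrightarrow> l u" for u
      using tendsto_uniform_limitI[OF tendsto_bcontfun_uniform_limit, of h l sequentially u] by simp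
    have "l (u + z) = l u" if "z \<in> Z" for u z
    proof (rule LIMSEQ_unique[OF lim])
      show "(\<lambda>k. h k (u + z)) \<longlonglongrightarrow> l u"
        using h that lim[of u] by (simp add: perturbations_def)
    qed
    then show "l \<in> perturbations"
      by (simp add: perturbations_def)
  qed
  then show ?thesis by (simp add: complete_eq_closed)
qed

text \<open>The height is a supremum of functions that are continuous in the perturbation.\<close>

lemma height_lsc:
  assumes A: "cocompact A" "A \<noteq> {}" and h: "\<And>k. h k \<in> perturbations" "\<And>k. height A (h k) \<le> a" "h \<longlonglongrightarrow> l"
  shows "height A l \<le> a"
  unfolding height_def
proof (rule cSUP_least[OF A(2)])
  fix u assume "u \<in> A"
  have "(\<lambda>k. h k u) \<longlonglongrightarrow> l u"
    using tendsto_uniform_limitI[OF tendsto_bcontfun_uniform_limit[OF h(3)], of u] by simp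
  then have "(\<lambda>k. u + h k u) \<longlonglongrightarrow> u + l u"
    by (intro tendsto_intros)
  then have "(\<lambda>k. f (u + h k u)) \<longlonglongrightarrow> f (u + l u)"
    using f_cont by (auto intro: continuous_on_tendsto_compose)
  moreover have "f (u + h k u) \<le> a" for k
    using f_le_height[OF A(1) h(1) \<open>u \<in> A\<close>] h(2) by (rule order_trans)
  ultimately show "f (u + l u) \<le> a"
    by (intro LIMSEQ_le_const2) auto
qed

section \<open>A periodic deformation that lowers the height\<close>

lemma infdist_orbit_add:
  assumes "z \<in> Z"
  shows "infdist (w + z) ((\<lambda>z. u + z) ` Z) = infdist w ((\<lambda>z. u + z) ` Z)"
proof -
  have "(\<lambda>z'. dist (w + z) (u + z')) ` Z = (\<lambda>z'. dist w (u + z')) ` Z"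
  proof (intro equalityI image_subsetI)
    fix z' assume "z' \<in> Z"
    have "dist (w + z) (u + z') = dist w (u + (z' - z))" "dist w (u + z') = dist (w + z) (u + (z' + z))"
      by (simp_all add: dist_norm algebra_simps)
    with \<open>z' \<in> Z\<close> assms show "dist (w + z) (u + z') \<in> (\<lambda>z'. dist w (u + z')) ` Z"
      "dist w (u + z') \<in> (\<lambda>z'. dist (w + z) (u + z')) ` Z"
      by (auto intro: Z_diff Z_add)
  qed
  then show ?thesis
    using Z_zero by (auto simp: infdist_def image_image)
qed

text \<open>Each maximum point has a direction of descent at rate \<open>\<sigma>\<close>. Finitely
  many of these directions are combined by continuous periodic weights into a displacement of norm
  at most \<open>t\<close> that lowers the height by at least \<open>\<sigma> * t\<close>.\<close>

lemma perturbation_improve: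
  assumes A: "cocompact A" "A \<noteq> {}" and h: "h \<in> perturbations" and \<sigma>: "\<sigma> > 0"
    and top: "\<And>u. u \<in> A \<Longrightarrow> f (u + h u) = height A h \<Longrightarrow> \<not> descent_rate_le f (u + h u) \<sigma>"
  obtains h' where "h' \<in> perturbations" "h' \<noteq> h" "height A h' + \<sigma> * dist h h' \<le> height A h"
proof -
  define H where "H = height A h"
  define M where "M = (A \<inter> Q) \<inter> {u. f (u + h u) = H}"
  have AQ: "compact (A \<inter> Q)" using A by (simp add: cocompact_def)
  have "compact M"
    unfolding M_def using f_perturbation_cont
    by (intro compact_Int_closed AQ closed_Collect_eq continuous_intros)
  obtain u0 where u0: "u0 \<in> A" "H = f (u0 + h u0)" and H: "\<And>v. v \<in> A \<Longrightarrow> f (v + h v) \<le> H"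
    using height_attained[OF A h] unfolding H_def by metis
  obtain z0 where "z0 \<in> Z" "u0 - z0 \<in> A \<inter> Q"
    using cocompactE[OF A(1) u0(1)] .
  then have "u0 - z0 \<in> M"
    using u0(2) f_perturbation_diff[OF h] by (simp add: M_def)
  then have "M \<noteq> {}" by blast
  \<comment> \<open>\<open>R\<close> is a radius of descent around \<open>u + h u\<close>. Points
    within \<open>r\<close> of \<open>u\<close> are sent only to \<open>R / 2\<close>, which leaves
    the other half for the displacement.\<close>
  define G where "G u v R r \<longleftrightarrow> norm v = 1 \<and> R > 0 \<and> r > 0 \<and>
      (\<forall>y t. dist (u + h u) y < R \<longrightarrow> 0 < t \<longrightarrow> t < R \<longrightarrow> f (y + t *\<^sub>R v) \<le> f y - \<sigma> * t) \<and>
      (\<forall>w. dist w u < r \<longrightarrow> dist (w + h w) (u + h u) < R / 2)" for u v R r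
  have "\<exists>v R r. G u v R r" if "u \<in> M" for u
  proof -
    have "\<not> descent_rate_le f (u + h u) \<sigma>"
      using that by (intro top) (auto simp: M_def H_def)
    then obtain v where v: "norm v = 1" "directional_bound f (u + h u) v (- \<sigma>)"
      using descent_direction \<sigma> by (metis less_imp_le)
    obtain R where R: "R > 0"
      "\<And>y t. \<lbrakk>dist (u + h u) y < R; 0 < t; t < R\<rbrakk> \<Longrightarrow> f (y + t *\<^sub>R v) \<le> f y + - \<sigma> * t"
      using directional_boundE[OF v(2)] by blast
    obtain r where r: "r > 0" "\<forall>w. dist w u < r \<longrightarrow> dist (w + h w) (u + h u) < R / 2"
      using perturbation_cont[of h] R(1) unfolding continuous_on_iff by (metis UNIV_I half_gt_zero)
    show ?thesis
      using v(1) R r unfolding G_def by (intro exI[of _ v] exI[of _ R] exI[of _ r]) auto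
  qed
  then obtain v R r where G: "\<And>u. u \<in> M \<Longrightarrow> G u (v u) (R u) (r u)"
    by metis
  have v: "norm (v u) = 1" and R: "R u > 0" and r: "r u > 0" if "u \<in> M" for u
    using G[OF that] by (simp_all add: G_def)
  have desc: "f (y + t *\<^sub>R v u) \<le> f y - \<sigma> * t"
    if "u \<in> M" "dist (u + h u) y < R u" "0 < t" "t < R u" for u y t
    using G[OF that(1)] that(2-) by (simp add: G_def)
  have near: "dist (w + h w) (u + h u) < R u / 2" if "u \<in> M" "dist w u < r u" for u w
    using G[OF that(1)] that(2) by (simp add: G_def)
  obtain F where F: "F \<subseteq> M" "finite F" "M \<subseteq> (\<Union>u\<in>F. ball u (r u))"
  proof (rule compactE_image[OF \<open>compact M\<close>, of M "\<lambda>u. ball u (r u)"])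
    show "M \<subseteq> (\<Union>u\<in>M. ball u (r u))"
      using r by (auto intro!: bexI)
  qed auto
  have "F \<noteq> {}" using F(3) \<open>M \<noteq> {}\<close> by auto
  \<comment> \<open>Measuring the distance to the whole orbit of \<open>u\<close> makes the weights
    periodic.\<close>
  define \<beta> where "\<beta> u w = max 0 (r u - infdist w ((\<lambda>z. u + z) ` Z))" for u w
  define B where "B w = (\<Sum>u\<in>F. \<beta> u w)" for w
  have \<beta>_cont: "continuous_on UNIV (\<beta> u)" for u
    unfolding \<beta>_def by (intro continuous_intros)
  have B_cont: "continuous_on UNIV B"
    unfolding B_def by (intro continuous_intros continuous_on_sum \<beta>_cont)
  have \<beta>_add: "\<beta> u (w + z) = \<beta> u w" if "z \<in> Z" for u w z
    unfolding \<beta>_def by (simp add: infdist_orbit_add[OF that])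
  have \<beta>_nonneg: "0 \<le> \<beta> u w" for u w
    by (simp add: \<beta>_def)
  have B_pos: "0 < B w" if "w \<in> M" for w
  proof -
    obtain u where u: "u \<in> F" "dist u w < r u"
      using F(3) \<open>w \<in> M\<close> by auto
    have "u + 0 \<in> (\<lambda>z. u + z) ` Z" using Z_zero by blast
    then have "infdist w ((\<lambda>z. u + z) ` Z) \<le> dist w u"
      using infdist_le[of "u + 0" _ w] by simp
    then have "0 < \<beta> u w" using u(2) by (simp add: \<beta>_def dist_commute)
    then show ?thesis
      unfolding B_def using u(1) F(2) \<beta>_nonneg by (intro sum_pos2[of F u]) auto
  qed
  obtain w0 where w0: "w0 \<in> M" "\<And>w. w \<in> M \<Longrightarrow> B w0 \<le> B w"
    using continuous_attains_inf[OF \<open>compact M\<close> \<open>M \<noteq> {}\<close> continuous_on_subset[OF B_cont subset_UNIV]]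
    by blast
  define \<kappa> where "\<kappa> = B w0 / 2"
  have \<kappa>: "\<kappa> > 0" "\<And>w. w \<in> M \<Longrightarrow> \<kappa> < B w"
    using B_pos[OF w0(1)] w0(2) by (force simp: \<kappa>_def)+
  \<comment> \<open>Where the total weight is at most \<open>\<kappa>\<close> there are no maximum
    points, so compactness leaves a margin \<open>\<eta>\<close> below the maximum.\<close>
  obtain \<eta> where \<eta>: "\<eta> > 0" "\<And>w. w \<in> A \<inter> Q \<Longrightarrow> B w \<le> \<kappa> \<Longrightarrow> f (w + h w) \<le> H - \<eta>"
  proof (cases "(A \<inter> Q) \<inter> {w. B w \<le> \<kappa>} = {}")
    case True
    then show ?thesis by (intro that[of 1]) auto
  next
    case False
    have "compact ((A \<inter> Q) \<inter> {w. B w \<le> \<kappa>})"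
      using B_cont by (intro compact_Int_closed AQ closed_Collect_le continuous_intros)
    then obtain w1 where w1: "w1 \<in> (A \<inter> Q) \<inter> {w. B w \<le> \<kappa>}"
      "\<And>w. w \<in> (A \<inter> Q) \<inter> {w. B w \<le> \<kappa>} \<Longrightarrow> f (w + h w) \<le> f (w1 + h w1)"
      using continuous_attains_sup[OF _ False continuous_on_subset[OF f_perturbation_cont subset_UNIV]] by metis
    have "w1 \<notin> M" using w1(1) \<kappa>(2)[of w1] by auto
    then have "f (w1 + h w1) < H"
      using w1(1) H[of w1] by (auto simp: M_def less_le)
    then show ?thesis
      using w1(2) by (intro that[of "H - f (w1 + h w1)"]) auto
  qed
  define \<epsilon> where "\<epsilon> = Min (R ` F) / 2"
  have \<epsilon>: "\<epsilon> > 0" "\<And>u. u \<in> F \<Longrightarrow> \<epsilon> \<le> R u / 2"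
    using R F \<open>F \<noteq> {}\<close> by (auto simp: \<epsilon>_def subset_iff)
  \<comment> \<open>The first bound keeps all moves inside the radii of descent, the second keeps
    the intended gain \<open>\<sigma> * t\<close> within the margin \<open>\<eta>\<close>.\<close>
  define t where "t = min (\<epsilon> / 2) (\<eta> / \<sigma>)"
  have t: "t > 0" "t < \<epsilon>" "\<sigma> * t \<le> \<eta>"
    using \<epsilon>(1) \<eta>(1) \<sigma> by (auto simp: t_def min_def field_simps)
  \<comment> \<open>Dividing by \<open>max (B w) \<kappa>\<close> keeps the weights continuous
    everywhere, with sum at most \<open>t\<close> and exactly \<open>t\<close> where
    \<open>\<kappa> \<le> B w\<close>.\<close>
  define \<tau> where "\<tau> w u = t * (\<beta> u w / max (B w) \<kappa>)" for w u
  have max_pos: "max (B w) \<kappa> > 0" for w using \<kappa>(1) by simp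
  have \<tau>_nonneg: "0 \<le> \<tau> w u" for w u
    using t(1) \<beta>_nonneg max_pos[of w] unfolding \<tau>_def by (intro mult_nonneg_nonneg divide_nonneg_pos) auto
  have \<tau>_sum: "(\<Sum>u\<in>F. \<tau> w u) = t * (B w / max (B w) \<kappa>)" for w
    unfolding \<tau>_def B_def by (simp add: sum_distrib_left sum_divide_distrib)
  have \<tau>_sum_le: "(\<Sum>u\<in>F. \<tau> w u) \<le> t" for w
  proof -
    have "B w / max (B w) \<kappa> \<le> 1" using max_pos[of w] by (simp add: divide_le_eq)
    then show ?thesis unfolding \<tau>_sum using t(1) by (intro mult_left_le) auto
  qed
  define \<phi> where "\<phi> w = (\<Sum>u\<in>F. \<tau> w u *\<^sub>R v u)" for w
  have \<phi>_norm: "norm (\<phi> w) \<le> t" for w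
  proof -
    have "norm (\<phi> w) \<le> (\<Sum>u\<in>F. \<tau> w u)"
      unfolding \<phi>_def
    proof (rule sum_norm_le)
      fix u assume "u \<in> F"
      then show "norm (\<tau> w u *\<^sub>R v u) \<le> \<tau> w u"
        using v[of u] F(1) \<tau>_nonneg[of w u] by auto
    qed
    then show ?thesis using \<tau>_sum_le[of w] by simp
  qed
  have \<phi>_cont: "continuous_on UNIV \<phi>"
    unfolding \<phi>_def \<tau>_def using max_pos
    by (intro continuous_intros \<beta>_cont B_cont) (auto simp: less_imp_neq[symmetric])
  define h' where "h' = h + Bcontfun \<phi>"
  have h': "h' w = h w + \<phi> w" for w
    using bcontfun_normI[OF \<phi>_cont \<phi>_norm] by (simp add: h'_def Bcontfun_inverse plus_bcontfun.rep_eq)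
  have B_add: "B (w + z) = B w" if "z \<in> Z" for w z
    unfolding B_def by (simp add: \<beta>_add[OF that])
  have "\<phi> (w + z) = \<phi> w" if "z \<in> Z" for w z
    unfolding \<phi>_def \<tau>_def by (simp add: \<beta>_add[OF that] B_add[OF that])
  then have "h' \<in> perturbations"
    using h by (simp add: perturbations_def h')
  have dec: "f (w + h' w) \<le> f (w + h w) - \<sigma> * (\<Sum>u\<in>F. \<tau> w u)" for w
  proof -
    have "f (w + h w + \<phi> w) \<le> f (w + h w) - \<sigma> * (\<Sum>u\<in>F. \<tau> w u)"
      unfolding \<phi>_def
    proof (rule successive_descent[of _ _ _ \<epsilon>])
      fix u y s assume u: "u \<in> F" "0 < \<tau> w u" and y: "dist (w + h w) y < \<epsilon>" and s: "0 < s" "s < \<epsilon>"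
      have "u \<in> M" using u F by blast
      \<comment> \<open>Positive weight means that \<open>w\<close> is close to some
        \<open>u + z\<close>. Subtracting \<open>z\<close> leads back to \<open>u\<close>, where the
        descent estimate is known, and periodicity of \<open>f\<close> carries it over.\<close>
      have "0 < \<beta> u w"
        using u(2) \<beta>_nonneg[of u w] by (cases "\<beta> u w = 0") (auto simp: \<tau>_def)
      then have "infdist w ((\<lambda>z. u + z) ` Z) < r u"
        by (simp add: \<beta>_def)
      then obtain z where z: "z \<in> Z" "dist w (u + z) < r u"
        using Z_zero cInf_lessD[of "(\<lambda>z. dist w (u + z)) ` Z" "r u"]
        by (auto simp: infdist_def image_image split: if_splits)
      then have "dist (w - z) u < r u"
        by (simp add: dist_norm algebra_simps)
      then have "dist (w - z + h (w - z)) (u + h u) < R u / 2"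
        by (rule near[OF \<open>u \<in> M\<close>])
      moreover have "dist (w - z + h (w - z)) (y - z) < R u / 2"
        using y \<epsilon>(2)[OF u(1)] perturbation_diff[OF h z(1)] by (simp add: dist_norm algebra_simps)
      ultimately have "dist (u + h u) (y - z) < R u"
        using dist_triangle[of "u + h u" "y - z" "w - z + h (w - z)"] by (simp add: dist_commute)
      then have "f (y - z + s *\<^sub>R v u) \<le> f (y - z) - \<sigma> * s"
        using s \<epsilon>(2)[OF u(1)] R[OF \<open>u \<in> M\<close>] by (intro desc \<open>u \<in> M\<close>) auto
      moreover have "y - z + s *\<^sub>R v u = (y + s *\<^sub>R v u) - z"
        by simp
      ultimately show "f (y + s *\<^sub>R v u) \<le> f y - \<sigma> * s"
        by (simp only: f_diff[OF z(1)])
    next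
      show "(\<Sum>u\<in>F. \<tau> w u) < \<epsilon>" using \<tau>_sum_le[of w] t(2) by simp
    qed (use F v \<tau>_nonneg in auto)
    then show ?thesis by (simp add: h' add.assoc)
  qed
  \<comment> \<open>The full step is made where the weight is large; elsewhere the margin
    suffices.\<close>
  have bound: "f (w + h' w) \<le> H - \<sigma> * t" if w: "w \<in> A" for w
  proof (cases "\<kappa> \<le> B w")
    case True
    then have "(\<Sum>u\<in>F. \<tau> w u) = t" using \<kappa>(1) by (simp add: \<tau>_sum)
    then show ?thesis using dec[of w] H[OF w] by simp
  next
    case False
    obtain z where z: "z \<in> Z" "w - z \<in> A \<inter> Q"
      using cocompactE[OF A(1) w] .
    have "B (w - z) = B w"
      using B_add[OF z(1), of "w - z"] by simp
    then have "f (w + h w) \<le> H - \<eta>"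
      using \<eta>(2)[OF z(2)] False f_perturbation_diff[OF h z(1)] by simp
    moreover have "0 \<le> \<sigma> * (\<Sum>u\<in>F. \<tau> w u)"
      using \<sigma> by (intro mult_nonneg_nonneg sum_nonneg \<tau>_nonneg) auto
    ultimately show ?thesis using dec[of w] t(3) by linarith
  qed
  have "height A h' \<le> H - \<sigma> * t"
    unfolding height_def by (intro cSUP_least A(2) bound)
  moreover have "dist h h' \<le> t"
    using \<phi>_norm by (intro dist_bound) (simp add: h' dist_norm)
  then have "\<sigma> * dist h h' \<le> \<sigma> * t" using \<sigma> by simp
  ultimately have le: "height A h' + \<sigma> * dist h h' \<le> H" by simp
  moreover have "0 < \<sigma> * t" using \<sigma> t(1) by simp
  then have "h' \<noteq> h"
    using \<open>height A h' \<le> H - \<sigma> * t\<close> by (auto simp: H_def)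
  ultimately show ?thesis
    using \<open>h' \<in> perturbations\<close> unfolding H_def by (intro that[of h'])
qed

text \<open>Ekeland's principle with slope \<open>\<sigma>\<close>, started within
  \<open>\<sigma>\<^sup>2\<close> of the lower bound \<open>c\<close>, moves the perturbation by at
  most \<open>\<sigma>\<close>.\<close>

lemma almost_critical_point:
  assumes A: "cocompact A" "A \<noteq> {}" and h0: "h0 \<in> perturbations" and \<sigma>: "\<sigma> > 0"
    and c: "\<And>h. h \<in> perturbations \<Longrightarrow> c \<le> height A h" "height A h0 \<le> c + \<sigma>\<^sup>2"
  obtains h u where "u \<in> A" "dist h0 h \<le> \<sigma>" "c \<le> f (u + h u)" "f (u + h u) \<le> c + \<sigma>\<^sup>2"
    "descent_rate_le f (u + h u) \<sigma>"
proof -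
  obtain h where h: "h \<in> perturbations" "height A h + \<sigma> * dist h0 h \<le> height A h0"
    "\<And>h'. \<lbrakk>h' \<in> perturbations; height A h' + \<sigma> * dist h h' \<le> height A h\<rbrakk> \<Longrightarrow> h' = h"
  proof (rule Ekeland_variational_principle[of perturbations h0 \<sigma> c "height A",
        OF complete_perturbations h0 \<sigma> c(1) height_lsc[OF A]])
    fix h assume "h \<in> perturbations" "height A h + \<sigma> * dist h0 h \<le> height A h0"
      "\<And>h'. \<lbrakk>h' \<in> perturbations; height A h' + \<sigma> * dist h h' \<le> height A h\<rbrakk> \<Longrightarrow> h' = h"
    then show thesis by (rule that)
  qed
  \<comment> \<open>If no maximum point had this descent rate, \<open>perturbation_improve\<close>
    would supply a competitor that Ekeland's principle excludes.\<close>
  obtain u where u: "u \<in> A" "f (u + h u) = height A h" "descent_rate_le f (u + h u) \<sigma>"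
    using perturbation_improve[OF A h(1) \<sigma>] h(3) by metis
  have "\<sigma> * dist h0 h \<le> \<sigma> * \<sigma>"
    using h(2) c(1)[OF h(1)] c(2) by (simp add: power2_eq_square)
  then have "dist h0 h \<le> \<sigma>" using \<sigma> by simp
  moreover have "0 \<le> \<sigma> * dist h0 h" using \<sigma> by simp
  ultimately show ?thesis
    using u h(2) c(1)[OF h(1)] c(2) by (intro that[of u h]) auto
qed

section \<open>Colouring sublevel sets by critical orbits\<close>

abbreviation orbit :: "'a \<Rightarrow> 'a set" where
  "orbit x \<equiv> coset_map Z -` {coset_map Z x}"

definition critical_points_at :: "real \<Rightarrow> 'a set" where
  "critical_points_at c = {x. critical_point f x \<and> f x = c}"

definition orbits_at :: "real \<Rightarrow> 'a set set" where
  "orbits_at c = orbit ` critical_points_at c"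

text \<open>The set and the perturbation are both quantified so that passing a level can apply the
  lower levels to a part of \<open>A\<close> and to every competing perturbation.\<close>

definition sublevel_colourable :: "'a set set \<Rightarrow> real \<Rightarrow> bool" where
  "sublevel_colourable C a \<longleftrightarrow> (\<forall>A. \<forall>h\<in>perturbations.
     cocompact A \<and> (\<forall>u\<in>A. f (u + apply_bcontfun h u) \<le> a) \<longrightarrow> colourable C A)"

lemma sublevel_colourableD:
  assumes "sublevel_colourable C a" "h \<in> perturbations" "cocompact A"
    "\<forall>u\<in>A. f (u + apply_bcontfun h u) \<le> a"
  shows "colourable C A"
proof -
  have "\<forall>h\<in>perturbations. cocompact A \<and> (\<forall>u\<in>A. f (u + apply_bcontfun h u) \<le> a) \<longrightarrow> colourable C A"
    using assms(1) unfolding sublevel_colourable_def by (rule spec)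
  from bspec[OF this assms(2)] show ?thesis
    by (rule mp) (intro conjI assms)
qed

lemma sublevel_colourable_mono:
  assumes "sublevel_colourable C b" "a \<le> b" "C \<subseteq> D"
  shows "sublevel_colourable D a"
  unfolding sublevel_colourable_def
proof (intro allI ballI impI)
  fix A h assume h: "h \<in> perturbations" and A: "cocompact A \<and> (\<forall>u\<in>A. f (u + apply_bcontfun h u) \<le> a)"
  then have "\<forall>u\<in>A. f (u + apply_bcontfun h u) \<le> b"
    using assms(2) by auto
  then have "colourable C A"
    using A by (intro sublevel_colourableD[OF assms(1) h]) auto
  then show "colourable D A"
    using assms(3) order_refl by (rule colourable_mono)
qed

lemma critical_points_at_add:
  assumes "x \<in> critical_points_at c" "z \<in> Z"
  shows "x + z \<in> critical_points_at c"
proof -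
  have "0 \<le> a" if "directional_bound f (x + z) v a" for v a
    using directional_bound_translate[OF f_periodic Z_minus[OF assms(2)] that] assms(1)
    by (simp add: critical_points_at_def critical_point_iff)
  then show ?thesis
    using assms by (simp add: critical_points_at_def critical_point_iff f_add)
qed

lemma orbits_at_disjoint:
  assumes "a \<noteq> b"
  shows "orbits_at a \<inter> orbits_at b = {}"
proof -
  have "f y = f x" if "orbit x = orbit y" for x y
  proof -
    have "y \<in> orbit x" using that by auto
    then have "y - x \<in> Z" using mem_orbit_iff[OF Z] by blast
    then show ?thesis using f_add[of "y - x" x] by simp
  qed
  note same = this
  show ?thesis
  proof (rule ccontr)
    assume "orbits_at a \<inter> orbits_at b \<noteq> {}"
    then obtain x y where "x \<in> critical_points_at a" "y \<in> critical_points_at b" "orbit x = orbit y"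
      unfolding orbits_at_def by blast
    then show False
      using same[of x y] assms by (simp add: critical_points_at_def)
  qed
qed

text \<open>The colour is the orbit of a nearby critical point and the piece is named by that point.
  Distinct points of one orbit are at least \<open>d\<close> apart, whereas labels of close points
  of one colour differ by less than three times \<open>d / 4\<close>.\<close>

lemma colourable_near_critical:
  assumes A: "cocompact A" and h: "h \<in> perturbations"
    and near: "B \<subseteq> A" "\<And>u. u \<in> B \<Longrightarrow> \<exists>x\<in>critical_points_at c. dist (u + h u) x < d / 4"
  shows "colourable (orbits_at c) B"
proof -
  obtain p where p: "\<And>u. u \<in> B \<Longrightarrow> p u \<in> critical_points_at c"
    "\<And>u. u \<in> B \<Longrightarrow> dist (u + h u) (p u) < d / 4"
    using near(2) by metis
  have AQ: "compact (A \<inter> Q)" using A by (simp add: cocompact_def)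
  have "d / 4 > 0" using d_pos by simp
  \<comment> \<open>The first point is translated into \<open>A \<inter> Q\<close>; the second,
    translated along with it, may fall outside \<open>Q\<close>.\<close>
  then obtain \<epsilon> where \<epsilon>: "\<epsilon> > 0"
    "\<And>q u. q \<in> A \<inter> Q \<Longrightarrow> dist q u \<le> \<epsilon> \<Longrightarrow> dist (q + h q) (u + h u) < d / 4"
    using uniformly_continuous_near_compact[OF AQ perturbation_cont] by metis
  obtain b where b: "\<And>u. norm (h u) \<le> b"
    using bounded_apply_bcontfun[of h] by (auto simp: bounded_iff)
  \<comment> \<open>Two points of a piece have images within \<open>d / 4\<close> of the same
    critical point, and \<open>h\<close> displaces each by at most \<open>b\<close>.\<close>
  have "colouring (orbits_at c) B (\<lambda>u. orbit (p u)) p \<epsilon> (d / 2 + 2 * b)"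
    unfolding colouring_def
  proof (intro conjI ballI impI)
    fix u v assume u: "u \<in> B" and v: "v \<in> B"
    show "p u = p v" if uv: "orbit (p u) = orbit (p v) \<and> dist u v \<le> \<epsilon>"
    proof (rule ccontr)
      assume "p u \<noteq> p v"
      have "p u \<in> orbit (p v)" using uv by auto
      then have "p u - p v \<in> Z" using mem_orbit_iff[OF Z] by blast
      then have "d \<le> dist (p u) (p v)"
        using d_le[of "p u - p v"] \<open>p u \<noteq> p v\<close> by (simp add: dist_norm)
      obtain z where z: "z \<in> Z" "u - z \<in> A \<inter> Q"
        using cocompactE[OF A] near(1) u by blast
      have "dist (u - z) (v - z) \<le> \<epsilon>"
        using uv by (simp add: dist_norm)
      then have "dist (u - z + h (u - z)) (v - z + h (v - z)) < d / 4"
        by (rule \<epsilon>(2)[OF z(2)])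
      then have "dist (u + h u) (v + h v) < d / 4"
        unfolding perturbation_diff[OF h z(1)] by (simp add: dist_norm algebra_simps)
      then show False
        using p(2)[OF u] p(2)[OF v] \<open>d \<le> dist (p u) (p v)\<close> d_pos
          dist_triangle3[of "p u" "p v" "u + h u"] dist_triangle[of "u + h u" "p v" "v + h v"]
        by linarith
    qed
    show "dist u v \<le> d / 2 + 2 * b" if "orbit (p u) = orbit (p v) \<and> p u = p v"
    proof -
      have "dist (u + h u) (v + h v) < d / 2"
        using p(2)[OF u] p(2)[OF v] that dist_triangle2[of "u + h u" "v + h v" "p v"] by simp
      moreover have "norm (u - v) \<le> norm (u + h u - (v + h v)) + norm (h v - h u)"
        using norm_triangle_ineq[of "u + h u - (v + h v)" "h v - h u"] by simp
      moreover have "norm (h v - h u) \<le> norm (h v) + norm (h u)"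
        by (rule norm_triangle_ineq4)
      ultimately show ?thesis
        using b[of u] b[of v] by (simp add: dist_norm)
    qed
  qed (use \<epsilon>(1) p(1) in \<open>auto simp: orbits_at_def\<close>)
  then show ?thesis
    unfolding colourable_def by (intro exI)
qed

lemma cocompact_far:
  assumes A: "cocompact A" and h: "h \<in> perturbations" and S: "\<And>x z. x \<in> S \<Longrightarrow> z \<in> Z \<Longrightarrow> x + z \<in> S"
  shows "cocompact {u\<in>A. \<forall>x\<in>S. \<delta> \<le> dist (u + h u) x}" (is "cocompact ?B")
  unfolding cocompact_def
proof (intro conjI ballI)
  have "?B \<inter> Q = (A \<inter> Q) \<inter> (\<Inter>x\<in>S. {u. \<delta> \<le> dist (u + h u) x})" by auto
  moreover have "compact ((A \<inter> Q) \<inter> (\<Inter>x\<in>S. {u. \<delta> \<le> dist (u + h u) x}))"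
  proof (rule compact_Int_closed)
    show "compact (A \<inter> Q)" using A by (simp add: cocompact_def)
    show "closed (\<Inter>x\<in>S. {u. \<delta> \<le> dist (u + h u) x})"
      by (intro closed_INT ballI closed_Collect_le continuous_intros perturbation_cont)
  qed
  ultimately show "compact (?B \<inter> Q)" by simp
next
  fix u z assume u: "u \<in> ?B" and z: "z \<in> Z"
  have "\<delta> \<le> dist (u + z + h (u + z)) x" if "x \<in> S" for x
  proof -
    have "x + - z \<in> S" using S[OF that Z_minus[OF z]] .
    then have "\<delta> \<le> dist (u + h u) (x + - z)" using u by blast
    then show ?thesis
      unfolding perturbation_add[OF h z] by (simp add: dist_norm algebra_simps)
  qed
  then show "u + z \<in> ?B" using A u z by (auto simp: cocompact_def)
next
  fix u assume "u \<in> ?B"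
  then show "\<exists>z\<in>Z. u - z \<in> Q" using A by (auto simp: cocompact_def)
qed

lemma sublevel_colourable_step:
  assumes below: "\<And>a. a < c \<Longrightarrow> sublevel_colourable C a" and disj: "C \<inter> orbits_at c = {}"
  obtains \<epsilon> where "\<epsilon> > 0" "sublevel_colourable (C \<union> orbits_at c) (c + \<epsilon>)"
proof (rule ccontr)
  assume "\<not> thesis"
  note extend = that
  have not: "\<not> sublevel_colourable (C \<union> orbits_at c) (c + \<epsilon>)" if "\<epsilon> > 0" for \<epsilon>
    using extend[OF that] \<open>\<not> thesis\<close> by blast
  define \<sigma> where "\<sigma> k = inverse (real (Suc k))" for k
  have \<sigma>_pos: "\<sigma> k > 0" for k by (simp add: \<sigma>_def)
  have \<sigma>_lim: "\<sigma> \<longlonglongrightarrow> 0"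
    unfolding \<sigma>_def by (rule LIMSEQ_inverse_real_of_nat)
  let ?S = "critical_points_at c"
  have "\<exists>x. c \<le> f x \<and> f x \<le> c + (\<sigma> k)\<^sup>2 \<and> descent_rate_le f x (\<sigma> k) \<and> (\<forall>y\<in>?S. d / 4 - \<sigma> k \<le> dist x y)" for k
  proof -
    \<comment> \<open>The excess \<open>(\<sigma> k)\<^sup>2\<close> over \<open>c\<close> is the
      tolerance of \<open>almost_critical_point\<close>.\<close>
    obtain A h where A: "cocompact A" "h \<in> perturbations" "\<And>u. u \<in> A \<Longrightarrow> f (u + h u) \<le> c + (\<sigma> k)\<^sup>2"
      "\<not> colourable (C \<union> orbits_at c) A"
      using not[of "(\<sigma> k)\<^sup>2"] \<sigma>_pos[of k] unfolding sublevel_colourable_def by auto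
    define B where "B = {u\<in>A. \<forall>x\<in>?S. d / 4 \<le> dist (u + h u) x}"
    have B: "cocompact B"
      unfolding B_def using A(1,2) critical_points_at_add by (rule cocompact_far)
    have "colourable (orbits_at c) (A - B)"
      using A(1,2) by (rule colourable_near_critical) (auto simp: B_def not_le)
    have notB: "\<not> colourable C B"
    proof
      assume "colourable C B"
      then have "colourable (C \<union> orbits_at c) (B \<union> (A - B))"
        using \<open>colourable (orbits_at c) (A - B)\<close> disj by (rule colourable_Un)
      moreover have "B \<union> (A - B) = A" by (auto simp: B_def)
      ultimately show False using A(4) by simp
    qed
    then have "B \<noteq> {}" using colourable_empty by metis
    \<comment> \<open>A perturbation of height below \<open>c\<close> would make \<open>B\<close>
      colourable by the lower orbits.\<close>
    have "c \<le> height B h'" if "h' \<in> perturbations" for h'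
    proof (rule ccontr)
      assume "\<not> ?thesis"
      then have "sublevel_colourable C (height B h')" by (intro below) simp
      then have "colourable C B"
        using f_le_height[OF B that] by (intro sublevel_colourableD[OF _ that B]) auto
      with notB show False ..
    qed
    moreover have "height B h \<le> c + (\<sigma> k)\<^sup>2"
      unfolding height_def using \<open>B \<noteq> {}\<close> A(3) by (intro cSUP_least) (auto simp: B_def)
    ultimately obtain h' u where u: "u \<in> B" "dist h h' \<le> \<sigma> k" "c \<le> f (u + h' u)"
      "f (u + h' u) \<le> c + (\<sigma> k)\<^sup>2" "descent_rate_le f (u + h' u) (\<sigma> k)"
      using almost_critical_point[OF B \<open>B \<noteq> {}\<close> A(2) \<sigma>_pos] by blast
    \<comment> \<open>\<open>B\<close> avoids the critical points under \<open>h\<close>; passing to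
      \<open>h'\<close> costs at most \<open>\<sigma> k\<close>.\<close>
    have "d / 4 - \<sigma> k \<le> dist (u + h' u) y" if "y \<in> ?S" for y
    proof -
      have "d / 4 \<le> dist (u + h u) y" using u(1) that by (simp add: B_def)
      moreover have "dist (u + h u) (u + h' u) \<le> \<sigma> k"
        using dist_bounded[of h u h'] u(2) by simp
      ultimately show ?thesis
        using dist_triangle[of "u + h u" y "u + h' u"] by simp
    qed
    with u show ?thesis by (intro exI[of _ "u + h' u"]) auto
  qed
  then obtain x where x: "\<And>k. c \<le> f (x k)" "\<And>k. f (x k) \<le> c + (\<sigma> k)\<^sup>2"
    "\<And>k. descent_rate_le f (x k) (\<sigma> k)" "\<And>k y. y \<in> ?S \<Longrightarrow> d / 4 - \<sigma> k \<le> dist (x k) y"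
    by metis
  have up: "(\<lambda>k. c + (\<sigma> k)\<^sup>2) \<longlonglongrightarrow> c"
    using tendsto_add[OF tendsto_const[of c] tendsto_power[OF \<sigma>_lim, of 2]] by simp
  have lim: "(\<lambda>k. f (x k)) \<longlonglongrightarrow> c"
    by (rule real_tendsto_sandwich[OF _ _ tendsto_const up]) (simp_all add: x(1,2))
  obtain y r z where y: "critical_point f y" "f y = c" "\<And>k. z k \<in> Z"
    "(\<lambda>k. x (r k) - z k) \<longlonglongrightarrow> y" "strict_mono r"
    using PS_condition_critical_limit[OF Z f_cont f_periodic f_PS lim \<sigma>_lim less_imp_le[OF \<sigma>_pos] x(3)]
    by blast
  have "y \<in> ?S" using y by (simp add: critical_points_at_def)
  \<comment> \<open>The translate \<open>y + z k\<close> is critical at level \<open>c\<close> too,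
    so the sequence stays away from its own limit.\<close>
  have "d / 4 - \<sigma> (r k) \<le> dist (x (r k) - z k) y" for k
    using x(4)[OF critical_points_at_add[OF \<open>y \<in> ?S\<close> y(3)[of k]], of "r k"]
    by (simp add: dist_norm algebra_simps)
  moreover have "(\<lambda>k. d / 4 - \<sigma> (r k)) \<longlonglongrightarrow> d / 4 - 0"
    using LIMSEQ_subseq_LIMSEQ[OF \<sigma>_lim y(5)] by (intro tendsto_intros) (simp add: o_def)
  moreover have "(\<lambda>k. dist (x (r k) - z k) y) \<longlonglongrightarrow> 0"
    using y(4) by (simp add: tendsto_dist_iff[symmetric])
  ultimately have "d / 4 - 0 \<le> 0"
    by (intro LIMSEQ_le) auto
  with d_pos show False by simp
qed

text \<open>At the infimum \<open>s\<close> of the failing levels, the step lemma reaches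
  \<open>s + \<epsilon>\<close> with orbits of level at most \<open>s\<close>, while some level
  between \<open>s\<close> and \<open>s + \<epsilon>\<close> fails.\<close>

lemma sublevel_colourable_orbits: "sublevel_colourable (\<Union>c\<in>{..a}. orbits_at c) a"
proof (rule ccontr)
  define S where "S = {a. \<not> sublevel_colourable (\<Union>c\<in>{..a}. orbits_at c) a}"
  assume "\<not> sublevel_colourable (\<Union>c\<in>{..a}. orbits_at c) a"
  then have "S \<noteq> {}" by (auto simp: S_def)
  \<comment> \<open>Below \<open>m\<close> only the empty set is mapped under the level.\<close>
  have "m \<le> b" if "b \<in> S" for b
  proof (rule ccontr)
    assume "\<not> m \<le> b"
    then have "\<not> f x \<le> b" for x using f_ge[of x] by linarith
    then have "A = {}" if "\<forall>u\<in>A. f (u + apply_bcontfun h u) \<le> b" for A h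
      using that by blast
    then have "sublevel_colourable (\<Union>c\<in>{..b}. orbits_at c) b"
      unfolding sublevel_colourable_def using colourable_empty by metis
    with that show False by (simp add: S_def)
  qed
  then have bdd: "bdd_below S" by (auto simp: bdd_below_def)
  define s where "s = Inf S"
  let ?C = "\<Union>c\<in>{..<s}. orbits_at c"
  have "sublevel_colourable ?C b" if "b < s" for b
  proof -
    have "b \<notin> S" using that cInf_lower[OF _ bdd] unfolding s_def by fastforce
    then have "sublevel_colourable (\<Union>c\<in>{..b}. orbits_at c) b" by (simp add: S_def)
    moreover have "(\<Union>c\<in>{..b}. orbits_at c) \<subseteq> ?C"
      using that by (intro UN_mono) auto
    ultimately show ?thesis
      by (rule sublevel_colourable_mono[OF _ order_refl])
  qed
  moreover have "?C \<inter> orbits_at s = {}"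
  proof -
    have "orbits_at c \<inter> orbits_at s = {}" if "c \<in> {..<s}" for c
      using that by (intro orbits_at_disjoint) auto
    then show ?thesis by blast
  qed
  ultimately obtain \<epsilon> where \<epsilon>: "\<epsilon> > 0" "sublevel_colourable (?C \<union> orbits_at s) (s + \<epsilon>)"
    by (rule sublevel_colourable_step)
  have "Inf S < s + \<epsilon>" using \<epsilon>(1) by (simp add: s_def)
  then obtain b where b: "b \<in> S" "b < s + \<epsilon>"
    using cInf_lessD[OF \<open>S \<noteq> {}\<close>] by blast
  have "s \<le> b" unfolding s_def using b(1) bdd by (rule cInf_lower)
  have "sublevel_colourable (\<Union>c\<in>{..b}. orbits_at c) b"
  proof (rule sublevel_colourable_mono[OF \<epsilon>(2)])
    have "orbits_at c \<subseteq> (\<Union>c\<in>{..b}. orbits_at c)" if "c \<le> s" for c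
      using that \<open>s \<le> b\<close> by (intro UN_upper) simp
    then show "?C \<union> orbits_at s \<subseteq> (\<Union>c\<in>{..b}. orbits_at c)"
      by (intro Un_least UN_least) auto
  qed (use b(2) in simp)
  with b(1) show False by (simp add: S_def)
qed

end

section \<open>Lattice generators and the number of critical orbits\<close>

text \<open>Subtracting the integer parts of the coefficients removes an element of \<open>Z\<close>
  and leaves coefficients between 0 and 1.\<close>

lemma span_subset_cube_add:
  fixes B :: "'a::real_normed_vector set"
  assumes Z: "additive_subgroup Z" and B: "finite B" "B \<subseteq> Z" and u: "u \<in> span B"
  obtains z where "z \<in> Z" "u - z \<in> cube B"
proof -
  have Z: "0 \<in> Z" "\<And>a b. a \<in> Z \<Longrightarrow> b \<in> Z \<Longrightarrow> a + b \<in> Z" "\<And>a. a \<in> Z \<Longrightarrow> - a \<in> Z"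
    using assms(1) by (auto simp: additive_subgroup_def)
  have nat: "real n *\<^sub>R b \<in> Z" if "b \<in> Z" for b n
    by (induction n) (use Z that in \<open>auto simp: scaleR_add_left\<close>)
  have int: "of_int k *\<^sub>R b \<in> Z" if "b \<in> Z" for b k
  proof (cases k)
    case (nonneg n)
    then show ?thesis using nat[OF that, of n] by simp
  next
    case (neg n)
    then show ?thesis
      using Z(3)[OF nat[OF that, of "Suc n"]]
      by (simp only: of_int_minus of_int_of_nat_eq scaleR_minus_left)
  qed
  obtain t where t: "u = (\<Sum>b\<in>B. t b *\<^sub>R b)"
    using u by (auto simp: span_finite[OF B(1)])
  have "(\<Sum>b\<in>F. of_int \<lfloor>t b\<rfloor> *\<^sub>R b) \<in> Z" if "F \<subseteq> B" "finite F" for F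
    using that(2,1) by (induction F) (use Z int B(2) in auto)
  then have "(\<Sum>b\<in>B. of_int \<lfloor>t b\<rfloor> *\<^sub>R b) \<in> Z" using B(1) by blast
  moreover have "u - (\<Sum>b\<in>B. of_int \<lfloor>t b\<rfloor> *\<^sub>R b) = (\<Sum>b\<in>B. (t b - of_int \<lfloor>t b\<rfloor>) *\<^sub>R b)"
    by (simp add: t scaleR_left_diff_distrib sum_subtractf)
  moreover have "(\<Sum>b\<in>B. (t b - of_int \<lfloor>t b\<rfloor>) *\<^sub>R b) \<in> cube B"
  proof -
    have "\<bar>x - of_int \<lfloor>x\<rfloor>\<bar> \<le> 1" for x :: real by linarith
    then show ?thesis
      unfolding cube_def by (intro CollectI exI[of _ "\<lambda>b. t b - of_int \<lfloor>t b\<rfloor>"]) simp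
  qed
  ultimately show ?thesis using that by simp
qed

text \<open>The infimum may be infinite for the trivial group, so a real number strictly between 0
  and the infimum is taken.\<close>

lemma discrete_subgroup_separated:
  assumes "discrete_subgroup Z"
  obtains d where "d > 0" "\<And>z. z \<in> Z \<Longrightarrow> z \<noteq> 0 \<Longrightarrow> d \<le> norm z"
proof -
  obtain d where d: "ereal 0 < ereal d" "ereal d < (INF z\<in>Z - {0}. ereal (norm z))"
    using assms ereal_dense2[of 0] by (auto simp: discrete_subgroup_def zero_ereal_def)
  have "d \<le> norm z" if "z \<in> Z" "z \<noteq> 0" for z
  proof -
    have "(INF z\<in>Z - {0}. ereal (norm z)) \<le> ereal (norm z)"
      using that by (intro INF_lower) auto
    then have "ereal d \<le> ereal (norm z)"
      using d(2) by order
    then show ?thesis by simp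
  qed
  with d(1) show ?thesis by (intro that) auto
qed

lemma locally_lipschitz_continuous:
  assumes "locally_lipschitz f"
  shows "continuous_on UNIV f"
  unfolding continuous_on_eq_continuous_at[OF open_UNIV]
proof
  fix x
  obtain r L where "r > 0" "L-lipschitz_on (ball x r) f"
    using assms unfolding locally_lipschitz_def by blast
  then have "continuous_on (ball x r) f" "x \<in> ball x r"
    by (auto intro: lipschitz_on_continuous_on)
  then show "isCont f x"
    by (auto simp: continuous_on_eq_continuous_at)
qed

text \<open>A basis of the span is chosen inside \<open>Z\<close>. If it is infinite it has subsets
  of every finite size; otherwise its size is the extended dimension.\<close>

lemma independent_subset_of_edim:
  fixes Z :: "'a::real_vector set"
  assumes "enat k \<le> edim (span Z)"
  obtains B where "B \<subseteq> Z" "independent B" "finite B" "card B = k"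
proof -
  obtain B where B: "B \<subseteq> Z" "independent B" "Z \<subseteq> span B" "card B = dim Z"
    by (rule basis_exists)
  have sub: "span Z \<subseteq> span B"
    using B(3) by (simp add: span_minimal)
  have "\<exists>F\<subseteq>B. finite F \<and> card F = k"
  proof (cases "finite B")
    case True
    then have "edim (span Z) = enat (dim (span Z))"
      using sub by (auto simp: edim_def)
    then have "k \<le> card B"
      using assms B(4) by simp
    then show ?thesis
      by (meson True finite_subset obtain_subset_with_card_n)
  next
    case False
    then show ?thesis
      using infinite_arbitrarily_large by metis
  qed
  then obtain F where "F \<subseteq> B" "finite F" "card F = k" by blast
  with B show ?thesis
    using independent_mono[OF B(2)] by (intro that[of F]) auto
qed

theorem theorem25:
  fixes f :: "'a::banach \<Rightarrow> real" and Z :: "'a set" and n :: enat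
  assumes "discrete_subgroup Z"
    and "n = edim (span Z)"
    and "locally_lipschitz f"
    and "periodic_wrt Z f"
    and "bdd_below (range f)"
    and "PS_condition Z f"
  shows "ecard (critical_orbits Z f) \<ge> n + 1"
proof (rule ccontr)
  assume less: "\<not> n + 1 \<le> ecard (critical_orbits Z f)"
  then have fin: "finite (critical_orbits Z f)"
    by (cases "finite (critical_orbits Z f)") (simp_all add: ecard_def)
  then have "\<not> n + 1 \<le> enat (card (critical_orbits Z f))"
    using less by (simp add: ecard_def)
  then have "enat (card (critical_orbits Z f)) \<le> n"
    by (cases n) (simp_all add: one_enat_def)
  then have "enat (card (critical_orbits Z f)) \<le> edim (span Z)"
    by (simp only: assms(2))
  \<comment> \<open>The number of vectors equals the number of orbits, so that the colours match the
    dimension of \<open>span B\<close> as in \<open>span_not_colourable\<close>.\<close>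
  then obtain B where B: "B \<subseteq> Z" "independent B" "finite B" "card B = card (critical_orbits Z f)"
    by (rule independent_subset_of_edim)
  obtain d where d: "d > 0" "\<And>z. z \<in> Z \<Longrightarrow> z \<noteq> 0 \<Longrightarrow> d \<le> norm z"
    using discrete_subgroup_separated[OF assms(1)] by blast
  obtain m where m: "\<And>x. m \<le> f x"
    using assms(5) by (auto simp: bdd_below_def)
  have sub: "additive_subgroup Z"
    using assms(1) by (simp add: discrete_subgroup_def)
  have cont: "continuous_on UNIV f"
    using assms(3) by (rule locally_lipschitz_continuous)
  interpret periodic_functional f Z "cube B" d m
    by unfold_locales (fact sub d cont assms(4,6) m compact_cube[OF B(3)])+
  \<comment> \<open>\<open>Z\<close> may exceed \<open>span B\<close>, so the span is enlarged to a
    set invariant under all of \<open>Z\<close>.\<close>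
  define V where "V = {u. \<exists>z\<in>Z. u - z \<in> cube B}"
  have "span B \<subseteq> V"
    unfolding V_def using span_subset_cube_add[OF sub B(3,1)] by blast
  have "u \<in> V" if "u \<in> cube B" for u
    unfolding V_def using that Z_zero by (auto intro: bexI[of _ 0])
  then have "V \<inter> cube B = cube B" by blast
  have "cocompact V"
    unfolding cocompact_def
  proof (intro conjI ballI)
    show "compact (V \<inter> cube B)"
      unfolding \<open>V \<inter> cube B = cube B\<close> by (rule Q)
  next
    fix u z assume "u \<in> V" "z \<in> Z"
    then obtain z' where "z' \<in> Z" "u - z' \<in> cube B" by (auto simp: V_def)
    then have "z' + z \<in> Z" "u + z - (z' + z) \<in> cube B"
      using Z_add \<open>z \<in> Z\<close> by simp_all
    then show "u + z \<in> V" unfolding V_def by blast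
  qed (simp add: V_def)
  have "0 \<in> perturbations"
    by (simp add: perturbations_def)
  \<comment> \<open>With the zero perturbation, this level admits the whole of
    \<open>V\<close>.\<close>
  define a where "a = height V 0"
  have "f (u + apply_bcontfun 0 u) \<le> a" if "u \<in> V" for u
    unfolding a_def using \<open>cocompact V\<close> \<open>0 \<in> perturbations\<close> that by (rule f_le_height)
  then have "colourable (\<Union>c\<in>{..a}. orbits_at c) V"
    using \<open>cocompact V\<close> \<open>0 \<in> perturbations\<close>
    by (intro sublevel_colourableD[OF sublevel_colourable_orbits]) auto
  moreover have "(\<Union>c\<in>{..a}. orbits_at c) \<subseteq> critical_orbits Z f"
    by (auto simp: orbits_at_def critical_points_at_def critical_orbits_def)
  ultimately have "colourable (critical_orbits Z f) (span B)"
    using \<open>span B \<subseteq> V\<close> by (rule colourable_mono)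
  with span_not_colourable[OF B(2,3) fin] B(4) show False by simp
qed

end
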